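(* If $\mathbf{C}$ is a locally small $\mathcal{M}$-category, then the $\mathcal{M}$-category $\mathcal{P}_{\mathcal{M}}(\mathbf{C})$ of small presheaves on $\mathbf{C}$ is a locally small $\mathcal{M}$-category.
   Context: A stable system of monics $\mathcal{M}_{\mathbf{C}}$ in a category $\mathbf{C}$ is a collection of monics containing all isomorphisms, closed under composition, and such that the pullback of any $m\in\mathcal{M}_{\mathbf{C}}$ along any map exists and lies in $\mathcal{M}_{\mathbf{C}}$. An $\mathcal{M}$-category is a category $\mathbf{C}$ with a stable system of monics $\mathcal{M}_{\mathbf{C}}$. An $\mathcal{M}$-subobject of $D$ is an isomorphism class (over $D$) of maps in $\mathcal{M}_{\mathbf{C}}$ with codomain $D$. An $\mathcal{M}$-category is locally small if its underlying category is locally small and it is $\mathcal{M}$-well-powered, i.e. the $\mathcal{M}$-subobjects of each object form a small partially ordered set. A presheaf on $\mathbf{C}$ is small if it is a small colimit of representables; $\mathcal{P}(\mathbf{C})$ is the category of small presheaves on $\mathbf{C}$, and $\mathbf{y}$ is the Yoneda embedding. $\mathcal{P}_{\mathcal{M}}(\mathbf{C})=(\mathcal{P}(\mathbf{C}),\mathcal{M}_{\mathcal{P}(\mathbf{C})})$, where $\mu\colon P\Rightarrow Q$ is in $\mathcal{M}_{\mathcal{P}(\mathbf{C})}$ iff for every $\gamma\colon\mathbf{y}D\Rightarrow Q$ there is a map $m\colon C\to D$ in $\mathcal{M}_{\mathbf{C}}$ such that $\mathbf{y}m$ is a pullback of $\mu$ along $\gamma$. For $\mathbf{C}$ a locally small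 $\mathcal{M}$-category, $\mathcal{M}_{\mathcal{P}(\mathbf{C})}$ is a stable system of monics. *)

theory Defs
  imports Main "HOL-Library.FuncSet"
begin

unbundle cardinal_syntax

section \<open>Universes\<close>

text \<open>
  Smallness is relative to a universe, given by an infinite regular strong limit cardinal: the
  small sets are those of cardinality below it.  The uncountable ones are the strongly
  inaccessible cardinals, i.e. the usual Grothendieck universes; countable infinity is allowed
  too, and then ``small'' means ``finite''.

  The cardinal is a well-order on a subset of \<open>'x\<close>, so that every small set, of whatever
  type, has a copy of type \<open>'x set\<close>.  Hence the small sets of type \<open>'x set\<close> and the functions
  between them form a category equivalent to that of all small sets, and we use them as the
  category \<open>Set\<close>.
\<close>

definition universe :: "'x rel \<Rightarrow> bool" where
  "universe \<kappa> \<longleftrightarrow> Card_order \<kappa> \<and> cinfinite \<kappa> \<and> regularCard \<kappa> \<and>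
     (\<forall>X :: 'x set. |X| <o \<kappa> \<longrightarrow> |Pow X| <o \<kappa>)"

definition small :: "'x rel \<Rightarrow> 'b set \<Rightarrow> bool" where
  "small \<kappa> X \<longleftrightarrow> |X| <o \<kappa>"


section \<open>Categories\<close>

record ('o, 'a) cat =
  Obj :: "'o set"
  Arr :: "'a set"
  Dom :: "'a \<Rightarrow> 'o"
  Cod :: "'a \<Rightarrow> 'o"
  Ident :: "'o \<Rightarrow> 'a"
  Comp :: "'a \<Rightarrow> 'a \<Rightarrow> 'a"  \<comment> \<open>\<open>Comp C g f\<close> is \<open>g\<close> after \<open>f\<close>\<close>

definition Hom :: "('o, 'a) cat \<Rightarrow> 'o \<Rightarrow> 'o \<Rightarrow> 'a set" where
  "Hom C A B = {f \<in> Arr C. Dom C f = A \<and> Cod C f = B}"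

locale category =
  fixes C :: "('o, 'a) cat"
  assumes Dom_in: "f \<in> Arr C \<Longrightarrow> Dom C f \<in> Obj C"
    and Cod_in: "f \<in> Arr C \<Longrightarrow> Cod C f \<in> Obj C"
    and Ident_in: "A \<in> Obj C \<Longrightarrow> Ident C A \<in> Hom C A A"
    and Comp_in: "f \<in> Hom C A B \<Longrightarrow> g \<in> Hom C B D \<Longrightarrow> Comp C g f \<in> Hom C A D"
    and Comp_Ident: "f \<in> Hom C A B \<Longrightarrow> Comp C f (Ident C A) = f"
    and Ident_Comp: "f \<in> Hom C A B \<Longrightarrow> Comp C (Ident C B) f = f"
    and Comp_assoc: "f \<in> Hom C A B \<Longrightarrow> g \<in> Hom C B D \<Longrightarrow> h \<in> Hom C D E \<Longrightarrow>
      Comp C h (Comp C g f) = Comp C (Comp C h g) f"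

definition locally_small_category :: "'x rel \<Rightarrow> ('o, 'a) cat \<Rightarrow> bool" where
  "locally_small_category \<kappa> C \<longleftrightarrow>
     category C \<and> (\<forall>A \<in> Obj C. \<forall>B \<in> Obj C. small \<kappa> (Hom C A B))"

definition small_category :: "'x rel \<Rightarrow> ('o, 'a) cat \<Rightarrow> bool" where
  "small_category \<kappa> J \<longleftrightarrow> category J \<and> small \<kappa> (Obj J) \<and> small \<kappa> (Arr J)"

definition full_subcategory :: "('o, 'a) cat \<Rightarrow> 'o set \<Rightarrow> ('o, 'a) cat" where
  "full_subcategory C S =
     C\<lparr>Obj := Obj C \<inter> S, Arr := {f \<in> Arr C. Dom C f \<in> S \<and> Cod C f \<in> S}\<rparr>"

definition monic :: "('o, 'a) cat \<Rightarrow> 'a \<Rightarrow> bool" where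
  "monic C m \<longleftrightarrow> m \<in> Arr C \<and>
     (\<forall>X \<in> Obj C. \<forall>f \<in> Hom C X (Dom C m). \<forall>g \<in> Hom C X (Dom C m).
        Comp C m f = Comp C m g \<longrightarrow> f = g)"

definition isomorphism :: "('o, 'a) cat \<Rightarrow> 'a \<Rightarrow> bool" where
  "isomorphism C i \<longleftrightarrow> i \<in> Arr C \<and>
     (\<exists>j \<in> Hom C (Cod C i) (Dom C i).
        Comp C j i = Ident C (Dom C i) \<and> Comp C i j = Ident C (Cod C i))"

text \<open>\<open>is_pullback C m f p q\<close>: the square \<open>f \<circ> p = m \<circ> q\<close> is cartesian, so that \<open>p\<close> is a pullback
  of \<open>m\<close> along \<open>f\<close>.\<close>

definition is_pullback :: "('o, 'a) cat \<Rightarrow> 'a \<Rightarrow> 'a \<Rightarrow> 'a \<Rightarrow> 'a \<Rightarrow> bool" where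
  "is_pullback C m f p q \<longleftrightarrow>
     m \<in> Arr C \<and> f \<in> Arr C \<and> p \<in> Arr C \<and> q \<in> Arr C \<and>
     Cod C m = Cod C f \<and> Dom C p = Dom C q \<and> Cod C p = Dom C f \<and> Cod C q = Dom C m \<and>
     Comp C f p = Comp C m q \<and>
     (\<forall>X \<in> Obj C. \<forall>u \<in> Hom C X (Dom C f). \<forall>v \<in> Hom C X (Dom C m).
        Comp C f u = Comp C m v \<longrightarrow>
        (\<exists>!h. h \<in> Hom C X (Dom C p) \<and> Comp C p h = u \<and> Comp C q h = v))"

record ('j, 'i, 'o, 'a) functr =
  Fobj :: "'j \<Rightarrow> 'o"
  Farr :: "'i \<Rightarrow> 'a"

definition is_functor ::
  "('j, 'i) cat \<Rightarrow> ('o, 'a) cat \<Rightarrow> ('j, 'i, 'o, 'a) functr \<Rightarrow> bool" where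
  "is_functor J C F \<longleftrightarrow>
     (\<forall>j \<in> Obj J. Fobj F j \<in> Obj C) \<and>
     (\<forall>u \<in> Arr J. Farr F u \<in> Hom C (Fobj F (Dom J u)) (Fobj F (Cod J u))) \<and>
     (\<forall>j \<in> Obj J. Farr F (Ident J j) = Ident C (Fobj F j)) \<and>
     (\<forall>u \<in> Arr J. \<forall>v \<in> Arr J. Dom J v = Cod J u \<longrightarrow>
        Farr F (Comp J v u) = Comp C (Farr F v) (Farr F u))"

definition is_cocone ::
  "('j, 'i) cat \<Rightarrow> ('o, 'a) cat \<Rightarrow> ('j, 'i, 'o, 'a) functr \<Rightarrow> 'o \<Rightarrow> ('j \<Rightarrow> 'a) \<Rightarrow> bool" where
  "is_cocone J C F X \<sigma> \<longleftrightarrow> X \<in> Obj C \<and>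
     (\<forall>j \<in> Obj J. \<sigma> j \<in> Hom C (Fobj F j) X) \<and>
     (\<forall>u \<in> Arr J. Comp C (\<sigma> (Cod J u)) (Farr F u) = \<sigma> (Dom J u))"

definition is_colimit ::
  "('j, 'i) cat \<Rightarrow> ('o, 'a) cat \<Rightarrow> ('j, 'i, 'o, 'a) functr \<Rightarrow> 'o \<Rightarrow> ('j \<Rightarrow> 'a) \<Rightarrow> bool" where
  "is_colimit J C F L \<iota> \<longleftrightarrow> is_cocone J C F L \<iota> \<and>
     (\<forall>X \<sigma>. is_cocone J C F X \<sigma> \<longrightarrow>
        (\<exists>!h. h \<in> Hom C L X \<and> (\<forall>j \<in> Obj J. Comp C h (\<iota> j) = \<sigma> j)))"


section \<open>Categories with a stable system of monics\<close>

definition stable_system :: "('o, 'a) cat \<Rightarrow> 'a set \<Rightarrow> bool" where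
  "stable_system C M \<longleftrightarrow>
     (\<forall>m \<in> M. monic C m) \<and>
     (\<forall>i. isomorphism C i \<longrightarrow> i \<in> M) \<and>
     (\<forall>m \<in> M. \<forall>n \<in> M. Dom C n = Cod C m \<longrightarrow> Comp C n m \<in> M) \<and>
     (\<forall>m \<in> M. \<forall>f \<in> Arr C. Cod C f = Cod C m \<longrightarrow>
        (\<exists>p q. is_pullback C m f p q) \<and> (\<forall>p q. is_pullback C m f p q \<longrightarrow> p \<in> M))"

definition M_category :: "('o, 'a) cat \<Rightarrow> 'a set \<Rightarrow> bool" where
  "M_category C M \<longleftrightarrow> category C \<and> stable_system C M"

definition iso_over :: "('o, 'a) cat \<Rightarrow> 'a set \<Rightarrow> 'o \<Rightarrow> 'a rel" where
  "iso_over C M D =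
     {(m, n). m \<in> M \<and> n \<in> M \<and> Cod C m = D \<and> Cod C n = D \<and>
        (\<exists>i \<in> Hom C (Dom C m) (Dom C n). isomorphism C i \<and> Comp C n i = m)}"

definition M_subobjects :: "('o, 'a) cat \<Rightarrow> 'a set \<Rightarrow> 'o \<Rightarrow> 'a set set" where
  "M_subobjects C M D = {m \<in> M. Cod C m = D} // iso_over C M D"

definition M_subobject_order :: "('o, 'a) cat \<Rightarrow> 'a set \<Rightarrow> 'o \<Rightarrow> 'a set rel" where
  "M_subobject_order C M D =
     {(U, V). U \<in> M_subobjects C M D \<and> V \<in> M_subobjects C M D \<and>
        (\<exists>m \<in> U. \<exists>n \<in> V. \<exists>h \<in> Hom C (Dom C m) (Dom C n). Comp C n h = m)}"

definition M_well_powered :: "'x rel \<Rightarrow> ('o, 'a) cat \<Rightarrow> 'a set \<Rightarrow> bool" where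
  "M_well_powered \<kappa> C M \<longleftrightarrow>
     (\<forall>D \<in> Obj C. small \<kappa> (M_subobjects C M D) \<and>
        partial_order_on (M_subobjects C M D) (M_subobject_order C M D))"

definition locally_small_M_category :: "'x rel \<Rightarrow> ('o, 'a) cat \<Rightarrow> 'a set \<Rightarrow> bool" where
  "locally_small_M_category \<kappa> C M \<longleftrightarrow>
     M_category C M \<and> locally_small_category \<kappa> C \<and> M_well_powered \<kappa> C M"


section \<open>Presheaves\<close>

text \<open>
  A presheaf on a category with arrows of type \<open>'a\<close> takes values in the small sets of type
  \<open>'a set\<close>.  The universe \<open>\<kappa> :: 'a rel\<close> lives on the same type, so this is no restriction (see
  above), and the hom-sets of \<open>C\<close> are themselves such values.  Demanding a universe on the type of
  arrows does not restrict \<open>C\<close> either: the type may be enlarged, as not all of it need be used.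
\<close>

record ('o, 'a) psh =
  Val :: "'o \<Rightarrow> 'a set"
  Act :: "'a \<Rightarrow> 'a \<Rightarrow> 'a"

text \<open>All functions are extensional, so that presheaves and transformations are
  equal as soon as they agree on the objects, arrows and elements that matter.\<close>

definition presheaf :: "'a rel \<Rightarrow> ('o, 'a) cat \<Rightarrow> ('o, 'a) psh \<Rightarrow> bool" where
  "presheaf \<kappa> C P \<longleftrightarrow>
     Val P \<in> extensional (Obj C) \<and> (\<forall>A \<in> Obj C. small \<kappa> (Val P A)) \<and>
     Act P \<in> (\<Pi>\<^sub>E f \<in> Arr C. Val P (Cod C f) \<rightarrow>\<^sub>E Val P (Dom C f)) \<and>
     (\<forall>A \<in> Obj C. \<forall>x \<in> Val P A. Act P (Ident C A) x = x) \<and>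
     (\<forall>f \<in> Arr C. \<forall>g \<in> Arr C. Dom C g = Cod C f \<longrightarrow>
        (\<forall>x \<in> Val P (Cod C g). Act P (Comp C g f) x = Act P f (Act P g x)))"

definition natural_transformations ::
  "('o, 'a) cat \<Rightarrow> ('o, 'a) psh \<Rightarrow> ('o, 'a) psh \<Rightarrow> ('o \<Rightarrow> 'a \<Rightarrow> 'a) set" where
  "natural_transformations C P Q =
     {\<tau> \<in> (\<Pi>\<^sub>E A \<in> Obj C. Val P A \<rightarrow>\<^sub>E Val Q A).
        \<forall>f \<in> Arr C. \<forall>x \<in> Val P (Cod C f).
          \<tau> (Dom C f) (Act P f x) = Act Q f (\<tau> (Cod C f) x)}"

type_synonym ('o, 'a) psh_arr = "('o, 'a) psh \<times> ('o, 'a) psh \<times> ('o \<Rightarrow> 'a \<Rightarrow> 'a)"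

definition presheaves :: "'a rel \<Rightarrow> ('o, 'a) cat \<Rightarrow> (('o, 'a) psh, ('o, 'a) psh_arr) cat" where
  "presheaves \<kappa> C =
     \<lparr>Obj = {P. presheaf \<kappa> C P},
      Arr = {(P, Q, \<tau>). presheaf \<kappa> C P \<and> presheaf \<kappa> C Q \<and> \<tau> \<in> natural_transformations C P Q},
      Dom = (\<lambda>(P, Q, \<tau>). P),
      Cod = (\<lambda>(P, Q, \<tau>). Q),
      Ident = (\<lambda>P. (P, P, \<lambda>A \<in> Obj C. \<lambda>x \<in> Val P A. x)),
      Comp = (\<lambda>(Q', R, \<sigma>) (P, Q, \<tau>). (P, R, \<lambda>A \<in> Obj C. compose (Val P A) (\<sigma> A) (\<tau> A)))\<rparr>"

definition yoneda_obj :: "('o, 'a) cat \<Rightarrow> 'o \<Rightarrow> ('o, 'a) psh" where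
  "yoneda_obj C D =
     \<lparr>Val = (\<lambda>A \<in> Obj C. Hom C A D),
      Act = (\<lambda>f \<in> Arr C. \<lambda>g \<in> Hom C (Cod C f) D. Comp C g f)\<rparr>"

definition yoneda_arr :: "('o, 'a) cat \<Rightarrow> 'a \<Rightarrow> ('o, 'a) psh_arr" where
  "yoneda_arr C m =
     (yoneda_obj C (Dom C m), yoneda_obj C (Cod C m),
      \<lambda>A \<in> Obj C. \<lambda>g \<in> Hom C A (Dom C m). Comp C m g)"

definition representable :: "'a rel \<Rightarrow> ('o, 'a) cat \<Rightarrow> ('o, 'a) psh \<Rightarrow> bool" where
  "representable \<kappa> C P \<longleftrightarrow>
     (\<exists>D \<in> Obj C. \<exists>i \<in> Hom (presheaves \<kappa> C) (yoneda_obj C D) P. isomorphism (presheaves \<kappa> C) i)"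

text \<open>Every small category is isomorphic to one with objects and arrows of type \<open>'a\<close>, so the type of
  the indexing category \<open>J\<close> is no restriction.\<close>

definition small_presheaf :: "'a rel \<Rightarrow> ('o, 'a) cat \<Rightarrow> ('o, 'a) psh \<Rightarrow> bool" where
  "small_presheaf \<kappa> C P \<longleftrightarrow>
     (\<exists>(J :: ('a, 'a) cat) F \<iota>. small_category \<kappa> J \<and> is_functor J (presheaves \<kappa> C) F \<and>
        (\<forall>j \<in> Obj J. representable \<kappa> C (Fobj F j)) \<and> is_colimit J (presheaves \<kappa> C) F P \<iota>)"

definition small_presheaves ::
  "'a rel \<Rightarrow> ('o, 'a) cat \<Rightarrow> (('o, 'a) psh, ('o, 'a) psh_arr) cat" where
  "small_presheaves \<kappa> C = full_subcategory (presheaves \<kappa> C) {P. small_presheaf \<kappa> C P}"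

definition presheaf_monics ::
  "'a rel \<Rightarrow> ('o, 'a) cat \<Rightarrow> 'a set \<Rightarrow> ('o, 'a) psh_arr set" where
  "presheaf_monics \<kappa> C M =
     {\<mu> \<in> Arr (small_presheaves \<kappa> C).
        \<forall>D \<in> Obj C. \<forall>\<gamma> \<in> Hom (small_presheaves \<kappa> C) (yoneda_obj C D) (Cod (small_presheaves \<kappa> C) \<mu>).
          \<exists>m \<in> M. \<exists>\<delta>. Cod C m = D \<and> is_pullback (small_presheaves \<kappa> C) \<mu> \<gamma> (yoneda_arr C m) \<delta>}"

end

theory Submission
  imports Defs
begin

text \<open>
  Everything rests on a description of small colimits of presheaves by elements. A cocone is
  colimiting exactly if, at every object \<open>A\<close>, its legs are jointly surjective and two elements of the
  diagram have the same image only if no predicate on the elements at \<open>A\<close> that is invariant under the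
  arrows of the diagram separates them (\<open>colimit_if_pointwise\<close>, \<open>pointwise_if_colimit\<close>). The second
  condition says that the two elements are linked by a zigzag, without mentioning zigzags. That
  colimits satisfy it is seen by mapping into the presheaf of subsets of \<open>Hom A -\<close>: every
  predicate on the elements of \<open>P\<close> at \<open>A\<close> is classified by a map from \<open>P\<close> into it, so the universal
  property applies to invariant predicates.

  Two consequences follow. First, a small presheaf \<open>P\<close> is generated under the action by a small set of
  elements \<open>(D, e)\<close> with \<open>e\<close> in \<open>P D\<close>, one for each representable in the diagram
  (\<open>small_presheaf_generators\<close>). Secondly, every subpresheaf of a colimit is the colimit of its
  preimages in the diagram (\<open>colimit_subpresheaf\<close>): membership in the subpresheaf is itself an
  invariant predicate.

  Local smallness holds because a transformation is determined by its values on the generators of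
  its domain.

  By the Yoneda lemma, a transformation \<open>\<mu>: P \<Rightarrow> Q\<close> of small presheaves is one of the distinguished
  monics iff it is pointwise injective and for every \<open>q\<close> in \<open>Q D\<close> the sieve of those \<open>g\<close> with
  codomain \<open>D\<close> for which the restriction of \<open>q\<close> along \<open>g\<close> lies in the image of \<open>\<mu>\<close> is the sieve of maps
  factoring through some \<open>m\<close> in \<open>M\<close> (\<open>presheaf_monics_iff\<close>). In this form, closure under isomorphisms,
  composition and pullback are short computations. The substantial point is that pullbacks
  exist among small presheaves. The pullback of \<open>\<mu>\<close> along \<open>f: R \<Rightarrow> Q\<close> is the subpresheaf of \<open>R\<close> of the
  elements that \<open>f\<close> sends into the image of \<open>\<mu>\<close>; it is the colimit of its preimages in the diagram of
  representables for \<open>R\<close>, and these are representable again, by the domains of the monics \<open>m\<close>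
  (\<open>small_subpresheaf\<close>, \<open>pullback_PM_exists\<close>).

  For well-poweredness, the image of a monic into \<open>Q\<close>, and hence its subobject, is determined by the
  sieves that it cuts out at the generators of \<open>Q\<close>. At a generator in \<open>Q D\<close> this sieve is generated by
  an \<open>M\<close>-subobject of \<open>D\<close>, and those form a small set (\<open>well_powered_PM\<close>).
\<close>

section \<open>Small sets\<close>

lemma small_inj:
  assumes "small \<kappa> Y" "inj_on f X" "f ` X \<subseteq> Y"
  shows "small \<kappa> X"
proof -
  have "|X| \<le>o |Y|" using assms(2,3) card_of_ordLeq by blast
  then show ?thesis using assms(1) unfolding small_def by (rule ordLeq_ordLess_trans)
qed

lemma small_subset: "small \<kappa> Y \<Longrightarrow> X \<subseteq> Y \<Longrightarrow> small \<kappa> X"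
  using small_inj[of \<kappa> Y id X] by simp

lemma small_image: "small \<kappa> X \<Longrightarrow> small \<kappa> (f ` X)"
  unfolding small_def by (rule ordLeq_ordLess_trans[OF card_of_image])

text \<open>
  The field of a universe sits inside \<open>'x\<close>, so a small set of any type has a copy in \<open>'x\<close>. This is
  what makes presheaves with values in \<open>'x set\<close> available from arbitrary small sets.
\<close>

lemma small_coding:
  fixes \<kappa> :: "'x rel" and X :: "'b set"
  assumes "universe \<kappa>" "small \<kappa> X"
  shows "\<exists>e :: 'b \<Rightarrow> 'x. inj_on e X"
proof -
  have "|X| \<le>o \<kappa>"
    using assms(2) unfolding small_def by (rule ordLess_imp_ordLeq)
  moreover have "\<kappa> =o |Field \<kappa>|"
    using assms(1) by (simp add: universe_def card_of_Field_ordIso ordIso_symmetric)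
  ultimately have "|X| \<le>o |Field \<kappa>|" by (rule ordLeq_ordIso_trans)
  then obtain e :: "'b \<Rightarrow> 'x" where "inj_on e X" using card_of_ordLeq[of X "Field \<kappa>"] by auto
  then show ?thesis by blast
qed

lemma small_finite:
  fixes \<kappa> :: "'x rel"
  assumes "universe \<kappa>" "finite X"
  shows "small \<kappa> X"
proof -
  have "Well_order \<kappa>" "\<not> finite (Field \<kappa>)"
    using assms(1) by (auto simp: universe_def cinfinite_def card_order_on_well_order_on)
  then show ?thesis
    unfolding small_def using assms(2) finite_ordLess_infinite[OF card_of_Well_order, of \<kappa> X]
    by (simp add: Field_card_of)
qed

text \<open>
  A universe is a strong limit for sets of its own type only; other sets are copied into that type.
\<close>

lemma small_Pow:
  fixes \<kappa> :: "'x rel" and X :: "'b set"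
  assumes "universe \<kappa>" "small \<kappa> X"
  shows "small \<kappa> (Pow X)"
proof -
  obtain e :: "'b \<Rightarrow> 'x" where e: "inj_on e X" using small_coding[OF assms] by blast
  have "small \<kappa> (Pow (e ` X))"
    using assms(1) small_image[OF assms(2), of e] by (simp add: universe_def small_def)
  moreover have "inj_on ((`) e) (Pow X)" using e by (simp add: inj_on_image_Pow)
  moreover have "(`) e ` Pow X \<subseteq> Pow (e ` X)" by auto
  ultimately show ?thesis by (rule small_inj)
qed

lemma small_UNION:
  assumes "universe \<kappa>" "small \<kappa> I" "\<And>i. i \<in> I \<Longrightarrow> small \<kappa> (B i)"
  shows "small \<kappa> (\<Union>i\<in>I. B i)"
  using assms unfolding universe_def small_def
  by (intro regularCard_UNION_bound) auto

lemma small_Sigma: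
  assumes "universe \<kappa>" "small \<kappa> I" "\<And>i. i \<in> I \<Longrightarrow> small \<kappa> (B i)"
  shows "small \<kappa> (Sigma I B)"
proof -
  have "small \<kappa> (\<Union>i\<in>I. Pair i ` B i)" by (intro small_UNION small_image assms)
  moreover have "Sigma I B = (\<Union>i\<in>I. Pair i ` B i)" by auto
  ultimately show ?thesis by simp
qed

text \<open>A function on \<open>I\<close> is determined by its graph, a subset of the disjoint union of the \<open>B i\<close>.\<close>

lemma small_PiE:
  assumes "universe \<kappa>" "small \<kappa> I" "\<And>i. i \<in> I \<Longrightarrow> small \<kappa> (B i)"
  shows "small \<kappa> (Pi\<^sub>E I B)"
proof (rule small_inj)
  show "small \<kappa> (Pow (Sigma I B))" by (intro small_Pow small_Sigma assms)
  show "inj_on (\<lambda>f. (\<lambda>i. (i, f i)) ` I) (Pi\<^sub>E I B)"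
  proof (rule inj_onI)
    fix f g assume f: "f \<in> Pi\<^sub>E I B" and g: "g \<in> Pi\<^sub>E I B"
      and eq: "(\<lambda>i. (i, f i)) ` I = (\<lambda>i. (i, g i)) ` I"
    show "f = g" by (rule PiE_ext[OF f g]) (use eq in auto)
  qed
  show "(\<lambda>f. (\<lambda>i. (i, f i)) ` I) ` Pi\<^sub>E I B \<subseteq> Pow (Sigma I B)" by auto
qed

text \<open>
  A class is recovered from the value of \<open>f\<close> on any of its members, so there are no more classes than
  values.
\<close>

lemma small_quotient:
  assumes "equiv X r" "small \<kappa> (f ` X)" "\<And>x y. x \<in> X \<Longrightarrow> y \<in> X \<Longrightarrow> f x = f y \<Longrightarrow> (x, y) \<in> r"
  shows "small \<kappa> (X // r)"
proof (rule small_subset)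
  show "small \<kappa> ((\<lambda>z. r `` {inv_into X f z}) ` f ` X)" using assms(2) by (rule small_image)
  show "X // r \<subseteq> (\<lambda>z. r `` {inv_into X f z}) ` f ` X"
  proof
    fix U assume "U \<in> X // r"
    then obtain x where x: "x \<in> X" "U = r `` {x}" by (rule quotientE)
    then have "(x, inv_into X f (f x)) \<in> r"
      by (intro assms(3)) (auto simp: inv_into_into f_inv_into_f)
    then have "U = r `` {inv_into X f (f x)}" using x(2) equiv_class_eq[OF assms(1)] by blast
    then show "U \<in> (\<lambda>z. r `` {inv_into X f z}) ` f ` X" using x(1) by blast
  qed
qed

section \<open>Subobjects in an arbitrary category with monics\<close>

context category
begin

lemma in_Hom_iff: "f \<in> Hom C A B \<longleftrightarrow> f \<in> Arr C \<and> Dom C f = A \<and> Cod C f = B"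
  by (simp add: Hom_def)

lemma Hom_Obj: "f \<in> Hom C A B \<Longrightarrow> A \<in> Obj C" "f \<in> Hom C A B \<Longrightarrow> B \<in> Obj C"
  using Dom_in Cod_in by (auto simp: in_Hom_iff)

lemma Ident_Arr: "A \<in> Obj C \<Longrightarrow> Ident C A \<in> Arr C \<and> Dom C (Ident C A) = A \<and> Cod C (Ident C A) = A"
  using Ident_in by (auto simp: in_Hom_iff)

lemma Comp_Arr: "f \<in> Arr C \<Longrightarrow> g \<in> Arr C \<Longrightarrow> Dom C g = Cod C f \<Longrightarrow>
    Comp C g f \<in> Arr C \<and> Dom C (Comp C g f) = Dom C f \<and> Cod C (Comp C g f) = Cod C g"
  using Comp_in[of f "Dom C f" "Cod C f" g "Cod C g"] by (auto simp: in_Hom_iff)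

lemma monicD:
  assumes "monic C m" "f \<in> Hom C X (Dom C m)" "g \<in> Hom C X (Dom C m)" "Comp C m f = Comp C m g"
  shows "f = g"
  using assms Hom_Obj(1)[OF assms(2)] unfolding monic_def by blast

lemma isomorphism_Ident: "A \<in> Obj C \<Longrightarrow> isomorphism C (Ident C A)"
  using Ident_in[of A] Ident_Comp[of "Ident C A" A A]
  by (auto simp: isomorphism_def in_Hom_iff)

lemma isomorphism_iff: "i \<in> Hom C A B \<Longrightarrow> isomorphism C i \<longleftrightarrow>
    (\<exists>j \<in> Hom C B A. Comp C j i = Ident C A \<and> Comp C i j = Ident C B)"
  by (auto simp: isomorphism_def in_Hom_iff)

lemma isomorphismI:
  assumes "i \<in> Hom C A B" "j \<in> Hom C B A" "Comp C j i = Ident C A" "Comp C i j = Ident C B"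
  shows "isomorphism C i"
  using assms by (auto simp: isomorphism_def in_Hom_iff)

lemma isomorphismE:
  assumes "isomorphism C i" "i \<in> Hom C A B"
  obtains j where "j \<in> Hom C B A" "Comp C j i = Ident C A" "Comp C i j = Ident C B"
    "isomorphism C j"
proof -
  from assms obtain j where j: "j \<in> Hom C B A" "Comp C j i = Ident C A" "Comp C i j = Ident C B"
    by (auto simp: isomorphism_def in_Hom_iff)
  moreover have "isomorphism C j" using isomorphismI[OF j(1) assms(2) j(3,2)] .
  ultimately show ?thesis using that by blast
qed

lemma isomorphism_Comp:
  assumes "isomorphism C i" "isomorphism C k" "i \<in> Hom C A B" "k \<in> Hom C B D"
  shows "isomorphism C (Comp C k i)"
proof -
  obtain j where j: "j \<in> Hom C B A" "Comp C j i = Ident C A" "Comp C i j = Ident C B"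
    using assms by (metis isomorphismE)
  obtain l where l: "l \<in> Hom C D B" "Comp C l k = Ident C B" "Comp C k l = Ident C D"
    using assms by (metis isomorphismE)
  have ki: "Comp C k i \<in> Hom C A D" and jl: "Comp C j l \<in> Hom C D A"
    using assms j l Comp_in by blast+
  have "Comp C (Comp C j l) (Comp C k i) = Comp C j (Comp C (Comp C l k) i)"
    using Comp_assoc[OF ki l(1) j(1)] Comp_assoc[OF assms(3,4) l(1)] by simp
  then have 1: "Comp C (Comp C j l) (Comp C k i) = Ident C A"
    using l j Ident_Comp[OF assms(3)] by simp
  have "Comp C (Comp C k i) (Comp C j l) = Comp C k (Comp C (Comp C i j) l)"
    using Comp_assoc[OF jl assms(3,4)] Comp_assoc[OF l(1) j(1) assms(3)] by simp
  then have 2: "Comp C (Comp C k i) (Comp C j l) = Ident C D"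
    using l j Ident_Comp[OF l(1)] by simp
  show ?thesis using isomorphismI[OF ki jl 1 2] .
qed

lemma equiv_iso_over:
  assumes "M \<subseteq> Arr C"
  shows "equiv {m \<in> M. Cod C m = D} (iso_over C M D)"
proof (rule equivI)
  show "iso_over C M D \<subseteq> {m \<in> M. Cod C m = D} \<times> {m \<in> M. Cod C m = D}"
    by (auto simp: iso_over_def)
  show "refl_on {m \<in> M. Cod C m = D} (iso_over C M D)"
  proof (rule refl_onI)
    fix m assume "m \<in> {m \<in> M. Cod C m = D}"
    then have m: "m \<in> M" "Cod C m = D" "m \<in> Hom C (Dom C m) D"
      using assms by (auto simp: in_Hom_iff)
    then have "Ident C (Dom C m) \<in> Hom C (Dom C m) (Dom C m)" "isomorphism C (Ident C (Dom C m))"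
      using Ident_in Hom_Obj isomorphism_Ident by auto
    then show "(m, m) \<in> iso_over C M D"
      using m Comp_Ident[OF m(3)] unfolding iso_over_def by blast
  qed
  show "sym (iso_over C M D)"
  proof (rule symI)
    fix m n assume "(m, n) \<in> iso_over C M D"
    then obtain i where mn: "m \<in> M" "n \<in> M" "Cod C m = D" "Cod C n = D"
      and i: "i \<in> Hom C (Dom C m) (Dom C n)" "isomorphism C i" "Comp C n i = m"
      by (auto simp: iso_over_def)
    obtain j where j: "j \<in> Hom C (Dom C n) (Dom C m)" "Comp C i j = Ident C (Dom C n)"
      "isomorphism C j" using i by (metis isomorphismE)
    have n: "n \<in> Hom C (Dom C n) D" using mn assms by (auto simp: in_Hom_iff)
    have "Comp C m j = n"
      using Comp_assoc[OF j(1) i(1) n] j(2) i(3) Comp_Ident[OF n] by simp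
    then show "(n, m) \<in> iso_over C M D" using mn j unfolding iso_over_def by blast
  qed
  show "trans (iso_over C M D)"
  proof (rule transI)
    fix m n l assume "(m, n) \<in> iso_over C M D" and "(n, l) \<in> iso_over C M D"
    then obtain i k where M: "m \<in> M" "l \<in> M" "n \<in> M" "Cod C m = D" "Cod C l = D"
      and i: "i \<in> Hom C (Dom C m) (Dom C n)" "isomorphism C i" "Comp C n i = m"
      and k: "k \<in> Hom C (Dom C n) (Dom C l)" "isomorphism C k" "Comp C l k = n"
      by (auto simp: iso_over_def)
    have l: "l \<in> Hom C (Dom C l) D" using M assms by (auto simp: in_Hom_iff)
    have "Comp C l (Comp C k i) = m" using Comp_assoc[OF i(1) k(1) l] i k by simp
    moreover have "isomorphism C (Comp C k i)" using isomorphism_Comp i k by blast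
    moreover have "Comp C k i \<in> Hom C (Dom C m) (Dom C l)" using Comp_in i k by blast
    ultimately show "(m, l) \<in> iso_over C M D" using M unfolding iso_over_def by blast
  qed
qed

text \<open>Monics that factor through each other do so by mutually inverse maps: cancel the monics.\<close>

lemma iso_over_antisym:
  assumes "monic C m" "monic C n" "m \<in> M" "n \<in> M" "Cod C m = D" "Cod C n = D"
    and h: "h \<in> Hom C (Dom C m) (Dom C n)" "Comp C n h = m"
    and k: "k \<in> Hom C (Dom C n) (Dom C m)" "Comp C m k = n"
  shows "(m, n) \<in> iso_over C M D"
proof -
  have m: "m \<in> Hom C (Dom C m) D" and n: "n \<in> Hom C (Dom C n) D"
    using assms by (auto simp: monic_def in_Hom_iff)
  have "Comp C m (Comp C k h) = Comp C m (Ident C (Dom C m))"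
    using Comp_assoc[OF h(1) k(1) m] h k Comp_Ident[OF m] by simp
  then have kh: "Comp C k h = Ident C (Dom C m)"
    using monicD[OF assms(1)] Comp_in[OF h(1) k(1)] Ident_in Hom_Obj(1)[OF m] by blast
  have "Comp C n (Comp C h k) = Comp C n (Ident C (Dom C n))"
    using Comp_assoc[OF k(1) h(1) n] h k Comp_Ident[OF n] by simp
  then have hk: "Comp C h k = Ident C (Dom C n)"
    using monicD[OF assms(2)] Comp_in[OF k(1) h(1)] Ident_in Hom_Obj(1)[OF n] by blast
  have "isomorphism C h" using isomorphismI[OF h(1) k(1) kh hk] .
  then show ?thesis using assms unfolding iso_over_def by blast
qed

lemma partial_order_M_subobjects:
  assumes monics: "\<And>m. m \<in> M \<Longrightarrow> monic C m"
  shows "partial_order_on (M_subobjects C M D) (M_subobject_order C M D)"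
proof -
  let ?X = "{m \<in> M. Cod C m = D}" and ?r = "iso_over C M D"
  have M: "M \<subseteq> Arr C" using monics by (auto simp: monic_def)
  have eq: "equiv ?X ?r" by (rule equiv_iso_over[OF M])
  have mem: "m \<in> ?X" if "U \<in> M_subobjects C M D" "m \<in> U" for U m
    using that eq in_quotient_imp_subset unfolding M_subobjects_def by blast
  have le: "\<exists>h \<in> Hom C (Dom C m) (Dom C n). Comp C n h = m" if "(m, n) \<in> ?r" for m n
    using that by (auto simp: iso_over_def)
  have rel: "(m, n) \<in> ?r" if "U \<in> M_subobjects C M D" "m \<in> U" "n \<in> U" for U m n
    using that quotient_eq_iff[OF eq, of U U m n] unfolding M_subobjects_def by blast
  have tr: "\<exists>h \<in> Hom C (Dom C m) (Dom C l). Comp C l h = m"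
    if "\<exists>h \<in> Hom C (Dom C m) (Dom C n). Comp C n h = m"
      "\<exists>h \<in> Hom C (Dom C n) (Dom C l). Comp C l h = n" "l \<in> ?X" for m n l
  proof -
    from that obtain h k where h: "h \<in> Hom C (Dom C m) (Dom C n)" "Comp C n h = m"
      and k: "k \<in> Hom C (Dom C n) (Dom C l)" "Comp C l k = n" by blast
    have "l \<in> Hom C (Dom C l) D" using that M by (auto simp: in_Hom_iff)
    then have "Comp C l (Comp C k h) = m" using Comp_assoc[OF h(1) k(1)] h k by simp
    then show ?thesis using Comp_in[OF h(1) k(1)] by blast
  qed
  \<comment> \<open>the order on classes can be tested on arbitrary representatives\<close>
  have all: "\<exists>h \<in> Hom C (Dom C m) (Dom C n). Comp C n h = m"
    if "(U, V) \<in> M_subobject_order C M D" "m \<in> U" "n \<in> V" for U V m n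
  proof -
    from that(1) obtain m' n' where UV: "U \<in> M_subobjects C M D" "V \<in> M_subobjects C M D"
      and m'n': "m' \<in> U" "n' \<in> V" "\<exists>h \<in> Hom C (Dom C m') (Dom C n'). Comp C n' h = m'"
      unfolding M_subobject_order_def by blast
    have "\<exists>h \<in> Hom C (Dom C m) (Dom C n'). Comp C n' h = m"
      using tr[OF le[OF rel] m'n'(3)] UV that(2) m'n'(1) mem[OF UV(2) m'n'(2)] by blast
    then show ?thesis
      using tr[OF _ le[OF rel]] UV that(3) m'n'(2) mem[OF UV(2) that(3)] by blast
  qed
  have ne: "\<exists>m. m \<in> U" if "U \<in> M_subobjects C M D" for U
    using that in_quotient_imp_non_empty[OF eq] unfolding M_subobjects_def by blast
  show ?thesis
    unfolding partial_order_on_def preorder_on_def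
  proof (intro conjI)
    show "M_subobject_order C M D \<subseteq> M_subobjects C M D \<times> M_subobjects C M D"
      by (auto simp: M_subobject_order_def)
    show "refl_on (M_subobjects C M D) (M_subobject_order C M D)"
    proof (rule refl_onI)
      fix U assume U: "U \<in> M_subobjects C M D"
      then obtain m where "m \<in> U" using ne by blast
      then show "(U, U) \<in> M_subobject_order C M D"
        using le[OF rel[OF U]] U unfolding M_subobject_order_def by blast
    qed
    show "trans (M_subobject_order C M D)"
    proof (rule transI)
      fix U V W assume UV: "(U, V) \<in> M_subobject_order C M D" and VW: "(V, W) \<in> M_subobject_order C M D"
      have mem': "U \<in> M_subobjects C M D" "V \<in> M_subobjects C M D" "W \<in> M_subobjects C M D"
        using UV VW by (auto simp: M_subobject_order_def)
      obtain m n l where mnl: "m \<in> U" "n \<in> V" "l \<in> W"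
        using ne[OF mem'(1)] ne[OF mem'(2)] ne[OF mem'(3)] by blast
      have "\<exists>h \<in> Hom C (Dom C m) (Dom C l). Comp C l h = m"
        by (rule tr[OF all[OF UV mnl(1,2)] all[OF VW mnl(2,3)] mem[OF mem'(3) mnl(3)]])
      then show "(U, W) \<in> M_subobject_order C M D"
        using mnl mem' unfolding M_subobject_order_def by blast
    qed
    show "antisym (M_subobject_order C M D)"
    proof (rule antisymI)
      fix U V assume UV: "(U, V) \<in> M_subobject_order C M D" and VU: "(V, U) \<in> M_subobject_order C M D"
      have mem': "U \<in> M_subobjects C M D" "V \<in> M_subobjects C M D"
        using UV by (auto simp: M_subobject_order_def)
      obtain m n where mn: "m \<in> U" "n \<in> V" using ne[OF mem'(1)] ne[OF mem'(2)] by blast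
      have "m \<in> ?X" "n \<in> ?X" by (rule mem[OF mem'(1) mn(1)], rule mem[OF mem'(2) mn(2)])
      then have "(m, n) \<in> ?r"
        using all[OF UV mn] all[OF VU mn(2,1)] monics[of m] monics[of n] iso_over_antisym[of m n M D]
        by auto
      then show "U = V"
        using quotient_eq_iff[OF eq] mem' mn unfolding M_subobjects_def by blast
    qed
  qed
qed

end

section \<open>Presheaves and natural transformations\<close>

abbreviation component :: "('o, 'a) psh_arr \<Rightarrow> 'o \<Rightarrow> 'a \<Rightarrow> 'a" where
  "component \<mu> \<equiv> snd (snd \<mu>)"

text \<open>
  Restricting to the relevant objects, arrows and elements makes the result extensional, so that it
  can be a presheaf.
\<close>

definition psh_of :: "('o, 'a) cat \<Rightarrow> ('o \<Rightarrow> 'a set) \<Rightarrow> ('a \<Rightarrow> 'a \<Rightarrow> 'a) \<Rightarrow> ('o, 'a) psh" where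
  "psh_of C V a = \<lparr>Val = (\<lambda>A \<in> Obj C. V A), Act = (\<lambda>f \<in> Arr C. \<lambda>x \<in> V (Cod C f). a f x)\<rparr>"

definition transformation ::
  "('o, 'a) cat \<Rightarrow> ('o, 'a) psh \<Rightarrow> ('o, 'a) psh \<Rightarrow> ('o \<Rightarrow> 'a \<Rightarrow> 'a) \<Rightarrow> ('o, 'a) psh_arr" where
  "transformation C P Q t = (P, Q, \<lambda>A \<in> Obj C. \<lambda>x \<in> Val P A. t A x)"

text \<open>
  The standing assumptions, with the universe on the type of the arrows as in the definition of
  presheaves.
\<close>

locale locally_small = category C for C :: "('o, 'a) cat" +
  fixes \<kappa> :: "'a rel"
  assumes universe: "universe \<kappa>"
    and small_Hom: "A \<in> Obj C \<Longrightarrow> B \<in> Obj C \<Longrightarrow> small \<kappa> (Hom C A B)"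
begin

abbreviation PSh where "PSh \<equiv> presheaves \<kappa> C"

lemma Act_in:
  "presheaf \<kappa> C P \<Longrightarrow> f \<in> Hom C A B \<Longrightarrow> x \<in> Val P B \<Longrightarrow> Act P f x \<in> Val P A"
  unfolding presheaf_def in_Hom_iff by (fastforce simp: PiE_iff Pi_iff)

lemma Act_Ident:
  "presheaf \<kappa> C P \<Longrightarrow> x \<in> Val P A \<Longrightarrow> A \<in> Obj C \<Longrightarrow> Act P (Ident C A) x = x"
  unfolding presheaf_def by blast

lemma Act_Comp:
  "presheaf \<kappa> C P \<Longrightarrow> f \<in> Hom C A B \<Longrightarrow> g \<in> Hom C B D \<Longrightarrow> x \<in> Val P D \<Longrightarrow>
    Act P (Comp C g f) x = Act P f (Act P g x)"
  unfolding presheaf_def in_Hom_iff by auto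

lemma small_Val: "presheaf \<kappa> C P \<Longrightarrow> A \<in> Obj C \<Longrightarrow> small \<kappa> (Val P A)"
  unfolding presheaf_def by blast

lemma presheaf_psh_of:
  assumes "\<And>A. A \<in> Obj C \<Longrightarrow> small \<kappa> (V A)"
    and "\<And>f A B x. f \<in> Hom C A B \<Longrightarrow> x \<in> V B \<Longrightarrow> a f x \<in> V A"
    and "\<And>A x. A \<in> Obj C \<Longrightarrow> x \<in> V A \<Longrightarrow> a (Ident C A) x = x"
    and "\<And>f g A B D x. f \<in> Hom C A B \<Longrightarrow> g \<in> Hom C B D \<Longrightarrow> x \<in> V D \<Longrightarrow>
      a (Comp C g f) x = a f (a g x)"
  shows "presheaf \<kappa> C (psh_of C V a)"
  unfolding presheaf_def
proof (intro conjI ballI impI)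
  show "Val (psh_of C V a) \<in> extensional (Obj C)" by (simp add: psh_of_def)
  show "small \<kappa> (Val (psh_of C V a) A)" if "A \<in> Obj C" for A
    using assms(1)[OF that] that by (simp add: psh_of_def)
  show "Act (psh_of C V a) \<in>
      (\<Pi>\<^sub>E f\<in>Arr C. Val (psh_of C V a) (Cod C f) \<rightarrow>\<^sub>E Val (psh_of C V a) (Dom C f))"
    using assms(2) by (auto simp: psh_of_def Dom_in Cod_in in_Hom_iff PiE_iff extensional_def)
  show "Act (psh_of C V a) (Ident C A) x = x" if "A \<in> Obj C" "x \<in> Val (psh_of C V a) A" for A x
    using that assms(3)[of A x] Ident_Arr[of A] by (simp add: psh_of_def)
  show "Act (psh_of C V a) (Comp C g f) x = Act (psh_of C V a) f (Act (psh_of C V a) g x)"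
    if "f \<in> Arr C" "g \<in> Arr C" "Dom C g = Cod C f" "x \<in> Val (psh_of C V a) (Cod C g)" for f g x
  proof -
    have "f \<in> Hom C (Dom C f) (Dom C g)" "g \<in> Hom C (Dom C g) (Cod C g)"
      using that by (auto simp: in_Hom_iff)
    then show ?thesis
      using that assms(4)[of f "Dom C f" "Dom C g" g "Cod C g" x] assms(2)[of g "Dom C g" "Cod C g" x]
        Comp_Arr[of f g]
      by (simp add: psh_of_def Cod_in)
  qed
qed

lemma Val_psh_of: "A \<in> Obj C \<Longrightarrow> Val (psh_of C V a) A = V A"
  by (simp add: psh_of_def)

lemma Act_psh_of: "f \<in> Hom C A B \<Longrightarrow> x \<in> V B \<Longrightarrow> Act (psh_of C V a) f x = a f x"
  by (auto simp: psh_of_def in_Hom_iff)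

lemma in_Hom_PSh: "\<mu> \<in> Hom PSh P Q \<longleftrightarrow> presheaf \<kappa> C P \<and> presheaf \<kappa> C Q \<and> fst \<mu> = P \<and>
    fst (snd \<mu>) = Q \<and> component \<mu> \<in> natural_transformations C P Q"
  unfolding Hom_def presheaves_def by (cases \<mu>) auto

lemma presheaf_Hom: "\<mu> \<in> Hom PSh P Q \<Longrightarrow> presheaf \<kappa> C P" "\<mu> \<in> Hom PSh P Q \<Longrightarrow> presheaf \<kappa> C Q"
  by (auto simp: in_Hom_PSh)

lemma component_in:
  "\<mu> \<in> Hom PSh P Q \<Longrightarrow> A \<in> Obj C \<Longrightarrow> x \<in> Val P A \<Longrightarrow> component \<mu> A x \<in> Val Q A"
  unfolding in_Hom_PSh natural_transformations_def by (auto simp: PiE_iff)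

lemma component_natural:
  "\<mu> \<in> Hom PSh P Q \<Longrightarrow> f \<in> Hom C A B \<Longrightarrow> x \<in> Val P B \<Longrightarrow>
    component \<mu> A (Act P f x) = Act Q f (component \<mu> B x)"
  unfolding in_Hom_PSh natural_transformations_def by (auto simp: in_Hom_iff)

lemma PSh_eqI:
  assumes "\<mu> \<in> Hom PSh P Q" "\<nu> \<in> Hom PSh P Q"
    and "\<And>A x. A \<in> Obj C \<Longrightarrow> x \<in> Val P A \<Longrightarrow> component \<mu> A x = component \<nu> A x"
  shows "\<mu> = \<nu>"
proof -
  have "component \<mu> = component \<nu>"
  proof (rule PiE_ext)
    show "component \<mu> \<in> (\<Pi>\<^sub>E A \<in> Obj C. Val P A \<rightarrow>\<^sub>E Val Q A)"
      and "component \<nu> \<in> (\<Pi>\<^sub>E A \<in> Obj C. Val P A \<rightarrow>\<^sub>E Val Q A)"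
      using assms(1,2) by (auto simp: in_Hom_PSh natural_transformations_def)
    then show "component \<mu> A = component \<nu> A" if "A \<in> Obj C" for A
      using assms(3) that by (auto intro!: PiE_ext[of _ "Val P A" "\<lambda>_. Val Q A"])
  qed
  then show ?thesis using assms(1,2) by (auto simp: in_Hom_PSh prod_eq_iff)
qed

lemma transformation_in_Hom:
  assumes "presheaf \<kappa> C P" "presheaf \<kappa> C Q"
    and "\<And>A x. A \<in> Obj C \<Longrightarrow> x \<in> Val P A \<Longrightarrow> t A x \<in> Val Q A"
    and "\<And>f A B x. f \<in> Hom C A B \<Longrightarrow> x \<in> Val P B \<Longrightarrow> t A (Act P f x) = Act Q f (t B x)"
  shows "transformation C P Q t \<in> Hom PSh P Q"
  using assms(1-3) assms(4)[of _ "Dom C _" "Cod C _"] Act_in[OF assms(1), of _ "Dom C _" "Cod C _"]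
  by (auto simp: in_Hom_PSh natural_transformations_def transformation_def Dom_in Cod_in in_Hom_iff)

lemma component_transformation:
  "A \<in> Obj C \<Longrightarrow> x \<in> Val P A \<Longrightarrow> component (transformation C P Q t) A x = t A x"
  by (simp add: transformation_def)

lemma Comp_PSh: "Comp PSh \<nu> \<mu> = (fst \<mu>, fst (snd \<nu>),
    \<lambda>A \<in> Obj C. compose (Val (fst \<mu>) A) (component \<nu> A) (component \<mu> A))"
  by (cases \<mu>, cases \<nu>) (simp add: presheaves_def)

lemma component_Comp:
  assumes "\<mu> \<in> Hom PSh P Q" "A \<in> Obj C" "x \<in> Val P A"
  shows "component (Comp PSh \<nu> \<mu>) A x = component \<nu> A (component \<mu> A x)"
  using assms by (simp add: in_Hom_PSh Comp_PSh compose_def)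

lemma component_Ident:
  "A \<in> Obj C \<Longrightarrow> x \<in> Val P A \<Longrightarrow> component (Ident PSh P) A x = x"
  by (simp add: presheaves_def)

lemma Ident_PSh_in: "presheaf \<kappa> C P \<Longrightarrow> Ident PSh P \<in> Hom PSh P P"
  using transformation_in_Hom[of P P "\<lambda>A x. x"]
  by (simp add: transformation_def presheaves_def)

lemma Comp_PSh_in:
  assumes \<mu>: "\<mu> \<in> Hom PSh P Q" and \<nu>: "\<nu> \<in> Hom PSh Q R"
  shows "Comp PSh \<nu> \<mu> \<in> Hom PSh P R"
proof -
  have "Comp PSh \<nu> \<mu> = transformation C P R (\<lambda>A x. component \<nu> A (component \<mu> A x))"
    using assms by (simp add: in_Hom_PSh Comp_PSh transformation_def compose_def)
  also have "\<dots> \<in> Hom PSh P R"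
    using assms component_in[OF \<mu>] component_in[OF \<nu>] component_natural[OF \<mu>]
      component_natural[OF \<nu>] Hom_Obj
    by (intro transformation_in_Hom) (auto simp: in_Hom_PSh)
  finally show ?thesis .
qed

lemma category_PSh: "category PSh"
proof
  fix f assume "f \<in> Arr PSh"
  then show "Dom PSh f \<in> Obj PSh" "Cod PSh f \<in> Obj PSh" by (auto simp: presheaves_def)
next
  fix P assume "P \<in> Obj PSh"
  then show "Ident PSh P \<in> Hom PSh P P" by (intro Ident_PSh_in) (simp add: presheaves_def)
next
  fix f g P Q R assume "f \<in> Hom PSh P Q" "g \<in> Hom PSh Q R"
  then show "Comp PSh g f \<in> Hom PSh P R" by (rule Comp_PSh_in)
next
  fix f P Q assume f: "f \<in> Hom PSh P Q"
  note I = Ident_PSh_in[OF presheaf_Hom(1)[OF f]] Ident_PSh_in[OF presheaf_Hom(2)[OF f]]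
  show "Comp PSh f (Ident PSh P) = f"
    using component_Comp[OF I(1)]
    by (intro PSh_eqI[OF Comp_PSh_in[OF I(1) f] f]) (simp add: component_Ident)
  show "Comp PSh (Ident PSh Q) f = f"
    using component_Comp[OF f] component_in[OF f]
    by (intro PSh_eqI[OF Comp_PSh_in[OF f I(2)] f]) (simp add: component_Ident)
next
  fix f g h P Q R S assume f: "f \<in> Hom PSh P Q" and g: "g \<in> Hom PSh Q R" and h: "h \<in> Hom PSh R S"
  show "Comp PSh h (Comp PSh g f) = Comp PSh (Comp PSh h g) f"
    using component_Comp[OF f] component_Comp[OF g] component_Comp[OF Comp_PSh_in[OF f g]]
      component_in[OF f]
    by (intro PSh_eqI[OF Comp_PSh_in[OF Comp_PSh_in[OF f g] h] Comp_PSh_in[OF f Comp_PSh_in[OF g h]]])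
      simp
qed

sublocale PSh: category PSh by (rule category_PSh)

text \<open>
  Pointwise inverses of a natural transformation are automatically natural.
\<close>

lemma isomorphism_PSh_iff:
  assumes i: "i \<in> Hom PSh P Q"
  shows "isomorphism PSh i \<longleftrightarrow> (\<forall>A \<in> Obj C. bij_betw (component i A) (Val P A) (Val Q A))"
proof
  assume "isomorphism PSh i"
  then obtain j where j: "j \<in> Hom PSh Q P" "Comp PSh j i = Ident PSh P" "Comp PSh i j = Ident PSh Q"
    using i by (metis PSh.isomorphismE)
  show "\<forall>A \<in> Obj C. bij_betw (component i A) (Val P A) (Val Q A)"
  proof
    fix A assume A: "A \<in> Obj C"
    show "bij_betw (component i A) (Val P A) (Val Q A)"
    proof (rule bij_betw_byWitness[where f' = "component j A"])
      show "\<forall>x\<in>Val P A. component j A (component i A x) = x"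
        using component_Comp[OF i A] component_Ident[OF A] j(2) by metis
      show "\<forall>x\<in>Val Q A. component i A (component j A x) = x"
        using component_Comp[OF j(1) A] component_Ident[OF A] j(3) by metis
    qed (use component_in[OF i A] component_in[OF j(1) A] in auto)
  qed
next
  assume bij: "\<forall>A \<in> Obj C. bij_betw (component i A) (Val P A) (Val Q A)"
  define t where "t A = inv_into (Val P A) (component i A)" for A
  have t: "t A y \<in> Val P A" "component i A (t A y) = y" if "A \<in> Obj C" "y \<in> Val Q A" for A y
    using bij that unfolding t_def bij_betw_def by (auto intro: inv_into_into f_inv_into_f)
  have ti: "t A (component i A x) = x" if "A \<in> Obj C" "x \<in> Val P A" for A x
    using bij that unfolding t_def bij_betw_def by (auto intro: inv_into_f_f)
  have nat: "t A (Act Q f y) = Act P f (t B y)" if f: "f \<in> Hom C A B" and y: "y \<in> Val Q B" for f A B y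
  proof -
    have "A \<in> Obj C" "B \<in> Obj C" using Hom_Obj[OF f] by auto
    then show ?thesis
      using component_natural[OF i f t(1)[OF _ y]] t(2)[OF _ y] Act_in[OF presheaf_Hom(1)[OF i] f]
        ti[of A] t(1)[OF _ y]
      by metis
  qed
  let ?j = "transformation C Q P t"
  have j: "?j \<in> Hom PSh Q P"
    by (rule transformation_in_Hom[OF presheaf_Hom(2)[OF i] presheaf_Hom(1)[OF i] t(1) nat])
  have "Comp PSh ?j i = Ident PSh P"
    by (rule PSh_eqI[OF Comp_PSh_in[OF i j] Ident_PSh_in[OF presheaf_Hom(1)[OF i]]])
      (simp add: component_Comp[OF i] component_Ident component_transformation component_in[OF i] ti)
  moreover have "Comp PSh i ?j = Ident PSh Q"
    by (rule PSh_eqI[OF Comp_PSh_in[OF j i] Ident_PSh_in[OF presheaf_Hom(2)[OF i]]])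
      (simp add: component_Comp[OF j] component_Ident component_transformation t)
  ultimately show "isomorphism PSh i" by (rule PSh.isomorphismI[OF i j])
qed

section \<open>Elements as maps from representables\<close>

abbreviation Y where "Y \<equiv> yoneda_obj C"

text \<open>
  The map out of the representable at \<open>D\<close> that the Yoneda lemma assigns to an element of \<open>P D\<close>.
\<close>

definition from_element :: "('o, 'a) psh \<Rightarrow> 'o \<Rightarrow> 'a \<Rightarrow> ('o, 'a) psh_arr" where
  "from_element P D x = transformation C (Y D) P (\<lambda>A g. Act P g x)"

lemma yoneda_obj_psh_of: "Y D = psh_of C (\<lambda>A. Hom C A D) (\<lambda>f g. Comp C g f)"
  by (simp add: yoneda_obj_def psh_of_def)

lemma Val_Y: "A \<in> Obj C \<Longrightarrow> Val (Y D) A = Hom C A D"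
  by (simp add: yoneda_obj_psh_of Val_psh_of)

lemma Act_Y: "f \<in> Hom C A B \<Longrightarrow> g \<in> Hom C B D \<Longrightarrow> Act (Y D) f g = Comp C g f"
  by (simp add: yoneda_obj_psh_of Act_psh_of)

lemma presheaf_Y: "D \<in> Obj C \<Longrightarrow> presheaf \<kappa> C (Y D)"
  unfolding yoneda_obj_psh_of
  by (rule presheaf_psh_of) (auto simp: small_Hom Comp_in Comp_Ident Comp_assoc)

lemma from_element_in:
  assumes P: "presheaf \<kappa> C P" and D: "D \<in> Obj C" and x: "x \<in> Val P D"
  shows "from_element P D x \<in> Hom PSh (Y D) P"
  unfolding from_element_def
proof (rule transformation_in_Hom[OF presheaf_Y[OF D] P])
  show "Act P g x \<in> Val P A" if "A \<in> Obj C" "g \<in> Val (Y D) A" for A g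
    using that Act_in[OF P _ x] by (simp add: Val_Y)
  show "Act P (Act (Y D) f g) x = Act P f (Act P g x)"
    if f: "f \<in> Hom C A B" and g: "g \<in> Val (Y D) B" for f A B g
    using g Hom_Obj[OF f] Act_Comp[OF P f _ x] by (simp add: Val_Y Act_Y[OF f])
qed

lemma component_from_element:
  "g \<in> Hom C A D \<Longrightarrow> component (from_element P D x) A g = Act P g x"
  using Hom_Obj by (simp add: from_element_def component_transformation Val_Y)

lemma yoneda:
  assumes \<gamma>: "\<gamma> \<in> Hom PSh (Y D) P" and g: "g \<in> Hom C A D"
  shows "component \<gamma> A g = Act P g (component \<gamma> D (Ident C D))"
proof -
  have D: "D \<in> Obj C" using Hom_Obj[OF g] by auto
  show ?thesis
    using component_natural[OF \<gamma> g, of "Ident C D"] Ident_in[OF D] D Act_Y[OF g Ident_in[OF D]] Ident_Comp[OF g]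
    by (simp add: Val_Y)
qed

lemma yoneda_element_in: "\<gamma> \<in> Hom PSh (Y D) P \<Longrightarrow> D \<in> Obj C \<Longrightarrow> component \<gamma> D (Ident C D) \<in> Val P D"
  by (rule component_in) (auto simp: Val_Y Ident_in)

lemma yoneda_arr_in:
  assumes "m \<in> Hom C A B"
  shows "yoneda_arr C m \<in> Hom PSh (Y A) (Y B)"
proof -
  have AB: "A \<in> Obj C" "B \<in> Obj C" using Hom_Obj[OF assms] by auto
  have "yoneda_arr C m = transformation C (Y A) (Y B) (\<lambda>X g. Comp C m g)"
    using assms AB by (auto simp: yoneda_arr_def transformation_def in_Hom_iff Val_Y intro!: restrict_ext)
  also have "\<dots> \<in> Hom PSh (Y A) (Y B)"
    using assms Comp_in Comp_assoc Hom_Obj AB Act_Y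
    by (intro transformation_in_Hom presheaf_Y) (auto simp: Val_Y)
  finally show ?thesis .
qed

lemma component_yoneda_arr:
  "m \<in> Hom C A B \<Longrightarrow> g \<in> Hom C X A \<Longrightarrow> component (yoneda_arr C m) X g = Comp C m g"
  using Hom_Obj[of g X A] by (simp add: yoneda_arr_def in_Hom_iff)

text \<open>
  A representation amounts to a universal element: one that generates the presheaf freely.
\<close>

lemma representable_iff:
  assumes P: "presheaf \<kappa> C P"
  shows "representable \<kappa> C P \<longleftrightarrow>
    (\<exists>D \<in> Obj C. \<exists>e \<in> Val P D. \<forall>A \<in> Obj C. bij_betw (\<lambda>g. Act P g e) (Hom C A D) (Val P A))"
proof
  assume "representable \<kappa> C P"
  then obtain D i where D: "D \<in> Obj C" and i: "i \<in> Hom PSh (Y D) P" and iso: "isomorphism PSh i"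
    unfolding representable_def by blast
  let ?e = "component i D (Ident C D)"
  have "bij_betw (\<lambda>g. Act P g ?e) (Hom C A D) (Val P A)" if A: "A \<in> Obj C" for A
  proof -
    have "bij_betw (component i A) (Hom C A D) (Val P A)"
      using iso A by (auto simp: isomorphism_PSh_iff[OF i] Val_Y)
    then show ?thesis using bij_betw_cong[of "Hom C A D", OF yoneda[OF i]] by simp
  qed
  then show "\<exists>D \<in> Obj C. \<exists>e \<in> Val P D. \<forall>A \<in> Obj C. bij_betw (\<lambda>g. Act P g e) (Hom C A D) (Val P A)"
    using D yoneda_element_in[OF i D] by blast
next
  assume "\<exists>D \<in> Obj C. \<exists>e \<in> Val P D. \<forall>A \<in> Obj C. bij_betw (\<lambda>g. Act P g e) (Hom C A D) (Val P A)"
  then obtain D e where D: "D \<in> Obj C" and e: "e \<in> Val P D"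
    and bij: "\<And>A. A \<in> Obj C \<Longrightarrow> bij_betw (\<lambda>g. Act P g e) (Hom C A D) (Val P A)" by blast
  have i: "from_element P D e \<in> Hom PSh (Y D) P" by (rule from_element_in[OF P D e])
  have "bij_betw (component (from_element P D e) A) (Val (Y D) A) (Val P A)" if A: "A \<in> Obj C" for A
    using bij[OF A] bij_betw_cong[of "Hom C A D", OF component_from_element] A by (simp add: Val_Y)
  then have "isomorphism PSh (from_element P D e)" by (simp add: isomorphism_PSh_iff[OF i])
  then show "representable \<kappa> C P" using D i unfolding representable_def by blast
qed

end

section \<open>Pointwise colimits of presheaves\<close>

text \<open>
  In the second clause \<open>T\<close> ranges over the predicates on the elements of the diagram at \<open>A\<close> that are
  invariant under its arrows. That no such predicate separates two elements means that they are
  connected by a zigzag of arrows of the diagram; quantifying over predicates replaces induction over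
  zigzags by a choice of the right \<open>T\<close>.
\<close>

definition pointwise_colimit ::
  "('o, 'a) cat \<Rightarrow> ('j, 'i) cat \<Rightarrow> ('j, 'i, ('o, 'a) psh, ('o, 'a) psh_arr) functr \<Rightarrow>
    ('o, 'a) psh \<Rightarrow> ('j \<Rightarrow> ('o, 'a) psh_arr) \<Rightarrow> bool" where
  "pointwise_colimit C J F L \<iota> \<longleftrightarrow> (\<forall>A \<in> Obj C.
     (\<forall>x \<in> Val L A. \<exists>j \<in> Obj J. \<exists>y \<in> Val (Fobj F j) A. component (\<iota> j) A y = x) \<and>
     (\<forall>T. (\<forall>u \<in> Arr J. \<forall>y \<in> Val (Fobj F (Dom J u)) A.
             T (Dom J u) y \<longleftrightarrow> T (Cod J u) (component (Farr F u) A y)) \<longrightarrow>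
          (\<forall>j \<in> Obj J. \<forall>j' \<in> Obj J. \<forall>y \<in> Val (Fobj F j) A. \<forall>y' \<in> Val (Fobj F j') A.
             component (\<iota> j) A y = component (\<iota> j') A y' \<longrightarrow> T j y \<longrightarrow> T j' y')))"

lemma pointwise_colimit_surj:
  assumes "pointwise_colimit C J F L \<iota>" "A \<in> Obj C" "x \<in> Val L A"
  obtains j y where "j \<in> Obj J" "y \<in> Val (Fobj F j) A" "component (\<iota> j) A y = x"
  using bspec[OF assms(1)[unfolded pointwise_colimit_def] assms(2), THEN conjunct1] assms(3) that
  by blast

lemma pointwise_colimit_invariant:
  assumes "pointwise_colimit C J F L \<iota>" "A \<in> Obj C"
    and "\<And>u y. u \<in> Arr J \<Longrightarrow> y \<in> Val (Fobj F (Dom J u)) A \<Longrightarrow>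
      T (Dom J u) y \<longleftrightarrow> T (Cod J u) (component (Farr F u) A y)"
    and "j \<in> Obj J" "j' \<in> Obj J" "y \<in> Val (Fobj F j) A" "y' \<in> Val (Fobj F j') A"
    and "component (\<iota> j) A y = component (\<iota> j') A y'" "T j y"
  shows "T j' y'"
  using assms(1)[unfolded pointwise_colimit_def, rule_format, OF assms(2), THEN conjunct2,
    rule_format, of T] assms(3-) by blast

text \<open>
  Both maps induce the same cocone on \<open>X\<close>, so they agree by the uniqueness half of the universal
  property.
\<close>

lemma (in category) colimit_unique:
  assumes J: "category J" and F: "is_functor J C F" and L: "is_colimit J C F L \<iota>"
    and h: "h \<in> Hom C L X" and h': "h' \<in> Hom C L X"
    and eq: "\<And>j. j \<in> Obj J \<Longrightarrow> Comp C h (\<iota> j) = Comp C h' (\<iota> j)"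
  shows "h = h'"
proof -
  have c: "is_cocone J C F L \<iota>" using L by (simp add: is_colimit_def)
  then have \<iota>: "\<iota> j \<in> Hom C (Fobj F j) L" if "j \<in> Obj J" for j
    using that by (simp add: is_cocone_def)
  have "is_cocone J C F X (\<lambda>j. Comp C h (\<iota> j))"
    unfolding is_cocone_def
  proof (intro conjI ballI)
    show "X \<in> Obj C" using Hom_Obj[OF h] by simp
    show "Comp C h (\<iota> j) \<in> Hom C (Fobj F j) X" if "j \<in> Obj J" for j
      by (rule Comp_in[OF \<iota>[OF that] h])
    show "Comp C (Comp C h (\<iota> (Cod J u))) (Farr F u) = Comp C h (\<iota> (Dom J u))" if u: "u \<in> Arr J" for u
    proof -
      have "Farr F u \<in> Hom C (Fobj F (Dom J u)) (Fobj F (Cod J u))"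
        using F u by (simp add: is_functor_def)
      moreover have "\<iota> (Cod J u) \<in> Hom C (Fobj F (Cod J u)) L"
        using \<iota> category.Cod_in[OF J u] by simp
      moreover have "Comp C (\<iota> (Cod J u)) (Farr F u) = \<iota> (Dom J u)"
        using c u by (simp add: is_cocone_def)
      ultimately show ?thesis using Comp_assoc[OF _ _ h] by metis
    qed
  qed
  then have "\<exists>!k. k \<in> Hom C L X \<and> (\<forall>j \<in> Obj J. Comp C k (\<iota> j) = Comp C h (\<iota> j))"
    using L by (simp add: is_colimit_def)
  then show ?thesis using h h' eq by metis
qed

context locally_small
begin

text \<open>
  The induced map sends the image of \<open>y\<close> under a leg of \<open>\<iota>\<close> to its image under the corresponding leg of
  \<open>\<sigma>\<close>. It is well defined because having a prescribed image under \<open>\<sigma>\<close> is an invariant predicate.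
\<close>

lemma colimit_if_pointwise:
  assumes J: "category J" and F: "is_functor J PSh F" and c: "is_cocone J PSh F L \<iota>"
    and pw: "pointwise_colimit C J F L \<iota>"
  shows "is_colimit J PSh F L \<iota>"
  unfolding is_colimit_def
proof (intro conjI allI impI)
  show "is_cocone J PSh F L \<iota>" by fact
  fix X \<sigma> assume s: "is_cocone J PSh F X \<sigma>"
  have L: "presheaf \<kappa> C L" and X: "presheaf \<kappa> C X"
    using c s by (auto simp: is_cocone_def presheaves_def)
  have \<iota>: "\<iota> j \<in> Hom PSh (Fobj F j) L" and \<sigma>: "\<sigma> j \<in> Hom PSh (Fobj F j) X" if "j \<in> Obj J" for j
    using that c s by (auto simp: is_cocone_def)
  have Fu: "Farr F u \<in> Hom PSh (Fobj F (Dom J u)) (Fobj F (Cod J u))" if "u \<in> Arr J" for u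
    using F that by (simp add: is_functor_def)
  have su: "component (\<sigma> (Dom J u)) A y = component (\<sigma> (Cod J u)) A (component (Farr F u) A y)"
    if "u \<in> Arr J" "A \<in> Obj C" "y \<in> Val (Fobj F (Dom J u)) A" for u A y
  proof -
    have "Comp PSh (\<sigma> (Cod J u)) (Farr F u) = \<sigma> (Dom J u)"
      using s that by (simp add: is_cocone_def)
    then show ?thesis using component_Comp[OF Fu[OF that(1)] that(2,3)] by metis
  qed
  have surj: "\<exists>j \<in> Obj J. \<exists>y \<in> Val (Fobj F j) A. component (\<iota> j) A y = x"
    if "A \<in> Obj C" "x \<in> Val L A" for A x
    using pointwise_colimit_surj[OF pw that] by blast
  have key: "component (\<sigma> j') A y' = component (\<sigma> j) A y"
    if A: "A \<in> Obj C" and j: "j \<in> Obj J" "y \<in> Val (Fobj F j) A"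
      and j': "j' \<in> Obj J" "y' \<in> Val (Fobj F j') A"
      and eq: "component (\<iota> j) A y = component (\<iota> j') A y'" for A j j' y y'
  proof -
    let ?T = "\<lambda>i z. component (\<sigma> i) A z = component (\<sigma> j) A y"
    have "?T j' y'"
      by (rule pointwise_colimit_invariant[OF pw A, where T = ?T and j = j and y = y])
        (use su A j j' eq in auto)
    then show ?thesis by simp
  qed
  define t where "t A x =
    (SOME z. \<exists>j \<in> Obj J. \<exists>y \<in> Val (Fobj F j) A. component (\<iota> j) A y = x \<and> z = component (\<sigma> j) A y)"
    for A x
  have t: "t A (component (\<iota> j) A y) = component (\<sigma> j) A y"
    if A: "A \<in> Obj C" and j: "j \<in> Obj J" "y \<in> Val (Fobj F j) A" for A j y
    unfolding t_def
  proof (rule some_equality)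
    show "\<exists>i\<in>Obj J. \<exists>z\<in>Val (Fobj F i) A. component (\<iota> i) A z = component (\<iota> j) A y \<and>
        component (\<sigma> j) A y = component (\<sigma> i) A z" using j by blast
    show "w = component (\<sigma> j) A y" if "\<exists>i\<in>Obj J. \<exists>z\<in>Val (Fobj F i) A.
        component (\<iota> i) A z = component (\<iota> j) A y \<and> w = component (\<sigma> i) A z" for w
      using that key[OF A j] by metis
  qed
  let ?h = "transformation C L X t"
  have h: "?h \<in> Hom PSh L X"
  proof (rule transformation_in_Hom[OF L X])
    show "t A x \<in> Val X A" if "A \<in> Obj C" "x \<in> Val L A" for A x
      using surj[OF that] t[OF that(1)] component_in[OF \<sigma> that(1)] by metis
    show "t A (Act L f x) = Act X f (t B x)" if f: "f \<in> Hom C A B" and x: "x \<in> Val L B" for f A B x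
    proof -
      have A: "A \<in> Obj C" and B: "B \<in> Obj C" using Hom_Obj[OF f] by auto
      obtain j y where j: "j \<in> Obj J" and y: "y \<in> Val (Fobj F j) B" and x_eq: "component (\<iota> j) B y = x"
        using surj[OF B x] by blast
      have fy: "Act (Fobj F j) f y \<in> Val (Fobj F j) A"
        using Act_in[OF presheaf_Hom(1)[OF \<iota>[OF j]] f y] .
      have "Act L f x = component (\<iota> j) A (Act (Fobj F j) f y)"
        using component_natural[OF \<iota>[OF j] f y] x_eq by simp
      then have "t A (Act L f x) = component (\<sigma> j) A (Act (Fobj F j) f y)"
        using t[OF A j fy] by simp
      also have "\<dots> = Act X f (t B x)"
        using component_natural[OF \<sigma>[OF j] f y] t[OF B j y] x_eq by simp
      finally show ?thesis .
    qed
  qed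
  have h\<iota>: "Comp PSh ?h (\<iota> j) = \<sigma> j" if j: "j \<in> Obj J" for j
    by (rule PSh_eqI[OF Comp_PSh_in[OF \<iota>[OF j] h] \<sigma>[OF j]])
      (simp add: component_Comp[OF \<iota>[OF j]] component_transformation component_in[OF \<iota>[OF j]] t j)
  show "\<exists>!h. h \<in> Hom PSh L X \<and> (\<forall>j \<in> Obj J. Comp PSh h (\<iota> j) = \<sigma> j)"
  proof (rule ex1I)
    show "?h \<in> Hom PSh L X \<and> (\<forall>j \<in> Obj J. Comp PSh ?h (\<iota> j) = \<sigma> j)" using h h\<iota> by blast
    fix k assume k: "k \<in> Hom PSh L X \<and> (\<forall>j \<in> Obj J. Comp PSh k (\<iota> j) = \<sigma> j)"
    show "k = ?h"
    proof (rule PSh_eqI[OF _ h])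
      show "k \<in> Hom PSh L X" using k by blast
      fix A x assume A: "A \<in> Obj C" and x: "x \<in> Val L A"
      obtain j y where j: "j \<in> Obj J" and y: "y \<in> Val (Fobj F j) A" and x_eq: "component (\<iota> j) A y = x"
        using surj[OF A x] by blast
      have "component k A x = component (\<sigma> j) A y"
        using component_Comp[OF \<iota>[OF j] A y, of k] k j x_eq by simp
      also have "\<dots> = component ?h A x" using t[OF A j y] x_eq x A by (simp add: component_transformation)
      finally show "component k A x = component ?h A x" .
    qed
  qed
qed

text \<open>
  The following presheaf takes \<open>B\<close> to the set of subsets of \<open>Hom A B\<close>, with inverse image along
  postcomposition as action. Values of presheaves must consist of elements of \<open>'a\<close>, so subsets are
  replaced by codes; these exist because the power set of a small set is small. A predicate \<open>T\<close> on
  \<open>P A\<close> gives a transformation \<open>classify P A T\<close> from \<open>P\<close> to this presheaf, which takes \<open>y\<close> in \<open>P B\<close> to the set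
  of arrows along which \<open>y\<close> restricts to an element of \<open>T\<close>; it determines \<open>T\<close>, since the identity of
  \<open>A\<close> belongs to the set assigned to \<open>y\<close> in \<open>P A\<close> iff \<open>T y\<close>.
\<close>

definition code :: "'o \<Rightarrow> 'o \<Rightarrow> 'a set \<Rightarrow> 'a" where
  "code A B = (SOME e. inj_on e (Pow (Hom C A B)))"

definition powerset_psh :: "'o \<Rightarrow> ('o, 'a) psh" where
  "powerset_psh A = psh_of C (\<lambda>B. code A B ` Pow (Hom C A B))
     (\<lambda>f z. code A (Dom C f)
        {g \<in> Hom C A (Dom C f). Comp C f g \<in> inv_into (Pow (Hom C A (Cod C f))) (code A (Cod C f)) z})"

definition classify :: "('o, 'a) psh \<Rightarrow> 'o \<Rightarrow> ('a \<Rightarrow> bool) \<Rightarrow> ('o, 'a) psh_arr" where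
  "classify P A T =
     transformation C P (powerset_psh A) (\<lambda>B y. code A B {g \<in> Hom C A B. T (Act P g y)})"

lemma inj_code:
  assumes "A \<in> Obj C" "B \<in> Obj C"
  shows "inj_on (code A B) (Pow (Hom C A B))"
proof -
  have "\<exists>e :: 'a set \<Rightarrow> 'a. inj_on e (Pow (Hom C A B))"
    using small_coding[OF universe small_Pow[OF universe small_Hom[OF assms]]] .
  then show ?thesis unfolding code_def by (rule someI_ex)
qed

lemma powerset_psh_act:
  assumes "A \<in> Obj C" "f \<in> Hom C B B'" "S \<subseteq> Hom C A B'"
  shows "code A (Dom C f)
      {g \<in> Hom C A (Dom C f). Comp C f g \<in> inv_into (Pow (Hom C A (Cod C f))) (code A (Cod C f)) (code A B' S)} =
    code A B {g \<in> Hom C A B. Comp C f g \<in> S}"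
proof -
  have "Dom C f = B" "Cod C f = B'" "B' \<in> Obj C" using assms(2) Hom_Obj by (auto simp: in_Hom_iff)
  then show ?thesis using inv_into_f_f[OF inj_code[OF assms(1)], of B' S] assms(3) by simp
qed

lemma presheaf_powerset_psh:
  assumes A: "A \<in> Obj C"
  shows "presheaf \<kappa> C (powerset_psh A)"
  unfolding powerset_psh_def
proof (rule presheaf_psh_of)
  show "small \<kappa> (code A B ` Pow (Hom C A B))" if "B \<in> Obj C" for B
    by (intro small_image small_Pow[OF universe] small_Hom A that)
next
  fix f B B' x assume f: "f \<in> Hom C B B'" and "x \<in> code A B' ` Pow (Hom C A B')"
  then obtain S where "x = code A B' S" "S \<subseteq> Hom C A B'" by blast
  then show "code A (Dom C f)
      {g \<in> Hom C A (Dom C f). Comp C f g \<in> inv_into (Pow (Hom C A (Cod C f))) (code A (Cod C f)) x}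
    \<in> code A B ` Pow (Hom C A B)"
    using powerset_psh_act[OF A f] by auto
next
  fix B x assume B: "B \<in> Obj C" and "x \<in> code A B ` Pow (Hom C A B)"
  then obtain S where S: "x = code A B S" "S \<subseteq> Hom C A B" by blast
  moreover have "{g \<in> Hom C A B. Comp C (Ident C B) g \<in> S} = S"
    using S(2) Ident_Comp by auto
  ultimately show "code A (Dom C (Ident C B))
      {g \<in> Hom C A (Dom C (Ident C B)). Comp C (Ident C B) g
        \<in> inv_into (Pow (Hom C A (Cod C (Ident C B)))) (code A (Cod C (Ident C B))) x} = x"
    using powerset_psh_act[OF A Ident_in[OF B]] by simp
next
  fix f g B B' D x assume f: "f \<in> Hom C B B'" and g: "g \<in> Hom C B' D" and "x \<in> code A D ` Pow (Hom C A D)"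
  then obtain S where S: "x = code A D S" "S \<subseteq> Hom C A D" by blast
  have "{h \<in> Hom C A B. Comp C (Comp C g f) h \<in> S} =
      {h \<in> Hom C A B. Comp C f h \<in> {h \<in> Hom C A B'. Comp C g h \<in> S}}"
    using Comp_assoc[OF _ f g] Comp_in[OF _ f] by auto
  moreover have "{h \<in> Hom C A B'. Comp C g h \<in> S} \<subseteq> Hom C A B'" by blast
  ultimately show "code A (Dom C (Comp C g f))
      {h \<in> Hom C A (Dom C (Comp C g f)). Comp C (Comp C g f) h
        \<in> inv_into (Pow (Hom C A (Cod C (Comp C g f)))) (code A (Cod C (Comp C g f))) x} =
    code A (Dom C f)
      {h \<in> Hom C A (Dom C f). Comp C f h \<in> inv_into (Pow (Hom C A (Cod C f))) (code A (Cod C f))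
        (code A (Dom C g)
          {h \<in> Hom C A (Dom C g). Comp C g h
            \<in> inv_into (Pow (Hom C A (Cod C g))) (code A (Cod C g)) x})}"
    using S powerset_psh_act[OF A Comp_in[OF f g]] powerset_psh_act[OF A f] powerset_psh_act[OF A g]
    by simp
qed

lemma classify_in:
  assumes P: "presheaf \<kappa> C P" and A: "A \<in> Obj C"
  shows "classify P A T \<in> Hom PSh P (powerset_psh A)"
  unfolding classify_def
proof (rule transformation_in_Hom[OF P presheaf_powerset_psh[OF A]])
  show "code A B {g \<in> Hom C A B. T (Act P g y)} \<in> Val (powerset_psh A) B" if "B \<in> Obj C" for B y
    using that by (auto simp: powerset_psh_def Val_psh_of)
next
  fix f B B' y assume f: "f \<in> Hom C B B'" and y: "y \<in> Val P B'"
  let ?S = "{g \<in> Hom C A B'. T (Act P g y)}"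
  have "{g \<in> Hom C A B. T (Act P g (Act P f y))} = {g \<in> Hom C A B. Comp C f g \<in> ?S}"
    using Act_Comp[OF P _ f y] Comp_in[OF _ f] by auto
  moreover have "Act (powerset_psh A) f (code A B' ?S) = code A B {g \<in> Hom C A B. Comp C f g \<in> ?S}"
    unfolding powerset_psh_def
    using powerset_psh_act[OF A f, of ?S] by (subst Act_psh_of[OF f]) auto
  ultimately show "code A B {g \<in> Hom C A B. T (Act P g (Act P f y))} =
      Act (powerset_psh A) f (code A B' ?S)"
    by simp
qed

lemma classify_eq_iff:
  assumes "presheaf \<kappa> C P" "presheaf \<kappa> C P'" "A \<in> Obj C" "y \<in> Val P A" "y' \<in> Val P' A"
    and "component (classify P A T) A y = component (classify P' A T') A y'"
  shows "T y \<longleftrightarrow> T' y'"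
proof -
  have "code A A {g \<in> Hom C A A. T (Act P g y)} = code A A {g \<in> Hom C A A. T' (Act P' g y')}"
    using assms by (simp add: classify_def component_transformation)
  then have "{g \<in> Hom C A A. T (Act P g y)} = {g \<in> Hom C A A. T' (Act P' g y')}"
    using inj_code[OF assms(3,3)] by (auto dest: inj_onD)
  then have "Ident C A \<in> {g \<in> Hom C A A. T (Act P g y)} \<longleftrightarrow> Ident C A \<in> {g \<in> Hom C A A. T' (Act P' g y')}"
    by (rule arg_cong)
  then show ?thesis
    using Ident_in[OF assms(3)] Act_Ident[OF assms(1,4,3)] Act_Ident[OF assms(2,5,3)] by simp
qed

lemma classify_Comp:
  assumes \<tau>: "\<tau> \<in> Hom PSh P Q" and A: "A \<in> Obj C"
    and T: "\<And>y. y \<in> Val P A \<Longrightarrow> T y \<longleftrightarrow> T' (component \<tau> A y)"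
  shows "Comp PSh (classify Q A T') \<tau> = classify P A T"
proof (rule PSh_eqI)
  note PQ = presheaf_Hom[OF \<tau>]
  show "Comp PSh (classify Q A T') \<tau> \<in> Hom PSh P (powerset_psh A)"
    by (rule Comp_PSh_in[OF \<tau> classify_in[OF PQ(2) A]])
  show "classify P A T \<in> Hom PSh P (powerset_psh A)" by (rule classify_in[OF PQ(1) A])
  fix B y assume B: "B \<in> Obj C" and y: "y \<in> Val P B"
  have "{g \<in> Hom C A B. T' (Act Q g (component \<tau> B y))} = {g \<in> Hom C A B. T (Act P g y)}"
    using component_natural[OF \<tau> _ y] T[OF Act_in[OF PQ(1) _ y]] by auto
  then show "component (Comp PSh (classify Q A T') \<tau>) B y = component (classify P A T) B y"
    using component_Comp[OF \<tau> B y] component_in[OF \<tau> B y] B y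
    by (simp add: classify_def component_transformation)
qed

text \<open>
  Transformations out of \<open>L\<close> are determined by their composites with the legs. For the predicate of
  being hit by some leg and the predicate that always holds these composites agree, so the two
  predicates agree on \<open>L\<close>; this is surjectivity. An invariant predicate yields a cocone, and the map
  that this induces from \<open>L\<close> shows that the predicate depends only on images in \<open>L\<close>.
\<close>

lemma pointwise_if_colimit:
  assumes J: "category J" and F: "is_functor J PSh F" and L: "is_colimit J PSh F L \<iota>"
  shows "pointwise_colimit C J F L \<iota>"
  unfolding pointwise_colimit_def
proof (rule ballI, rule conjI)
  fix A assume A: "A \<in> Obj C"
  have c: "is_cocone J PSh F L \<iota>" using L by (simp add: is_colimit_def)
  then have psh: "presheaf \<kappa> C L" by (simp add: is_cocone_def presheaves_def)
  have \<iota>: "\<iota> j \<in> Hom PSh (Fobj F j) L" if "j \<in> Obj J" for j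
    using that c by (auto simp: is_cocone_def)
  have Fu: "Farr F u \<in> Hom PSh (Fobj F (Dom J u)) (Fobj F (Cod J u))" if "u \<in> Arr J" for u
    using F that by (simp add: is_functor_def)
  show "\<forall>x \<in> Val L A. \<exists>j \<in> Obj J. \<exists>y \<in> Val (Fobj F j) A. component (\<iota> j) A y = x"
  proof
    fix x assume x: "x \<in> Val L A"
    let ?T = "\<lambda>x. \<exists>j \<in> Obj J. \<exists>y \<in> Val (Fobj F j) A. component (\<iota> j) A y = x"
    have "classify L A ?T = classify L A (\<lambda>_. True)"
    proof (rule PSh.colimit_unique[OF J F L classify_in[OF psh A] classify_in[OF psh A]])
      fix j assume j: "j \<in> Obj J"
      have "Comp PSh (classify L A ?T) (\<iota> j) = classify (Fobj F j) A (\<lambda>_. True)"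
        using j by (intro classify_Comp[OF \<iota>[OF j] A]) blast
      also have "\<dots> = Comp PSh (classify L A (\<lambda>_. True)) (\<iota> j)"
        by (intro classify_Comp[OF \<iota>[OF j] A, symmetric]) simp
      finally show "Comp PSh (classify L A ?T) (\<iota> j) = Comp PSh (classify L A (\<lambda>_. True)) (\<iota> j)" .
    qed
    then show "?T x" using classify_eq_iff[OF psh psh A x x, of ?T "\<lambda>_. True"] by simp
  qed
  show "\<forall>T. (\<forall>u \<in> Arr J. \<forall>y \<in> Val (Fobj F (Dom J u)) A.
             T (Dom J u) y \<longleftrightarrow> T (Cod J u) (component (Farr F u) A y)) \<longrightarrow>
          (\<forall>j \<in> Obj J. \<forall>j' \<in> Obj J. \<forall>y \<in> Val (Fobj F j) A. \<forall>y' \<in> Val (Fobj F j') A.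
             component (\<iota> j) A y = component (\<iota> j') A y' \<longrightarrow> T j y \<longrightarrow> T j' y')"
  proof (intro allI impI ballI)
    fix T j j' y y'
    assume T: "\<forall>u \<in> Arr J. \<forall>y \<in> Val (Fobj F (Dom J u)) A.
        T (Dom J u) y \<longleftrightarrow> T (Cod J u) (component (Farr F u) A y)"
      and j: "j \<in> Obj J" "j' \<in> Obj J" and y: "y \<in> Val (Fobj F j) A" "y' \<in> Val (Fobj F j') A"
      and eq: "component (\<iota> j) A y = component (\<iota> j') A y'" and Ty: "T j y"
    have pj: "presheaf \<kappa> C (Fobj F i)" if "i \<in> Obj J" for i
      using presheaf_Hom(1)[OF \<iota>[OF that]] .
    let ?\<sigma> = "\<lambda>j. classify (Fobj F j) A (T j)"
    have "is_cocone J PSh F (powerset_psh A) ?\<sigma>"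
      unfolding is_cocone_def
    proof (intro conjI ballI)
      show "powerset_psh A \<in> Obj PSh" using presheaf_powerset_psh[OF A] by (simp add: presheaves_def)
      show "?\<sigma> i \<in> Hom PSh (Fobj F i) (powerset_psh A)" if "i \<in> Obj J" for i
        by (rule classify_in[OF pj[OF that] A])
      show "Comp PSh (?\<sigma> (Cod J u)) (Farr F u) = ?\<sigma> (Dom J u)" if u: "u \<in> Arr J" for u
        using T u by (intro classify_Comp[OF Fu[OF u] A]) blast
    qed
    then obtain h where h: "\<forall>i \<in> Obj J. Comp PSh h (\<iota> i) = ?\<sigma> i"
      using L unfolding is_colimit_def by blast
    have "component (?\<sigma> j) A y = component (?\<sigma> j') A y'"
      using component_Comp[OF \<iota>[OF j(1)] A y(1), of h] component_Comp[OF \<iota>[OF j(2)] A y(2), of h] h j eq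
      by simp
    then show "T j' y'"
      using classify_eq_iff[OF pj[OF j(1)] pj[OF j(2)] A y] Ty by blast
  qed
qed

section \<open>Small presheaves\<close>

lemma presheaf_small_presheaf: "small_presheaf \<kappa> C P \<Longrightarrow> presheaf \<kappa> C P"
  by (auto simp: small_presheaf_def is_colimit_def is_cocone_def presheaves_def)

text \<open>
  A representable is the colimit of the one-object diagram at itself.
\<close>

lemma small_presheaf_Y:
  assumes D: "D \<in> Obj C"
  shows "small_presheaf \<kappa> C (Y D)"
proof -
  \<comment> \<open>the type of arrows is inhabited, and any inhabitant can name the one object and arrow\<close>
  define J :: "('a, 'a) cat" where
    "J = \<lparr>Obj = {undefined}, Arr = {undefined}, Dom = (\<lambda>_. undefined), Cod = (\<lambda>_. undefined),
      Ident = (\<lambda>_. undefined), Comp = (\<lambda>_ _. undefined)\<rparr>"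
  define F :: "('a, 'a, ('o, 'a) psh, ('o, 'a) psh_arr) functr" where
    "F = \<lparr>Fobj = (\<lambda>_. Y D), Farr = (\<lambda>_. Ident PSh (Y D))\<rparr>"
  let ?\<iota> = "\<lambda>_ :: 'a. Ident PSh (Y D)"
  have I: "Ident PSh (Y D) \<in> Hom PSh (Y D) (Y D)" by (rule Ident_PSh_in[OF presheaf_Y[OF D]])
  have II: "Comp PSh (Ident PSh (Y D)) (Ident PSh (Y D)) = Ident PSh (Y D)"
    by (rule PSh.Comp_Ident[OF I])
  have Y: "Y D \<in> Obj PSh" using presheaf_Y[OF D] by (simp add: presheaves_def)
  have cJ: "category J" by unfold_locales (auto simp: J_def Hom_def)
  have J: "small_category \<kappa> J"
    by (simp add: small_category_def cJ) (simp add: J_def small_finite[OF universe])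
  have F: "is_functor J PSh F" using I II Y by (simp add: is_functor_def F_def J_def)
  have c: "is_cocone J PSh F (Y D) ?\<iota>" using I II Y by (simp add: is_cocone_def F_def J_def)
  have "pointwise_colimit C J F (Y D) ?\<iota>"
    by (auto simp: pointwise_colimit_def F_def J_def component_Ident)
  then have L: "is_colimit J PSh F (Y D) ?\<iota>" by (rule colimit_if_pointwise[OF cJ F c])
  have "representable \<kappa> C (Y D)"
    using D I PSh.isomorphism_Ident[OF Y] unfolding representable_def by blast
  then have "\<forall>j \<in> Obj J. representable \<kappa> C (Fobj F j)" by (simp add: F_def)
  then show ?thesis using J F L unfolding small_presheaf_def by blast
qed

text \<open>
  The universal elements of the representables in the diagram, pushed into the colimit, generate it.
\<close>

lemma small_presheaf_generators:
  assumes "small_presheaf \<kappa> C P"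
  obtains G where "small \<kappa> G" "\<And>D e. (D, e) \<in> G \<Longrightarrow> D \<in> Obj C \<and> e \<in> Val P D"
    "\<And>A x. A \<in> Obj C \<Longrightarrow> x \<in> Val P A \<Longrightarrow> \<exists>(D, e) \<in> G. \<exists>g \<in> Hom C A D. x = Act P g e"
proof -
  obtain J :: "('a, 'a) cat" and F \<iota> where J: "small_category \<kappa> J" and F: "is_functor J PSh F"
    and rep: "\<forall>j \<in> Obj J. representable \<kappa> C (Fobj F j)" and L: "is_colimit J PSh F P \<iota>"
    using assms unfolding small_presheaf_def by blast
  have cJ: "category J" and sJ: "small \<kappa> (Obj J)" using J by (auto simp: small_category_def)
  have \<iota>: "\<iota> j \<in> Hom PSh (Fobj F j) P" if "j \<in> Obj J" for j
    using that L by (auto simp: is_colimit_def is_cocone_def)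
  have "\<forall>j \<in> Obj J. \<exists>D e. D \<in> Obj C \<and> e \<in> Val (Fobj F j) D \<and>
      (\<forall>A \<in> Obj C. bij_betw (\<lambda>g. Act (Fobj F j) g e) (Hom C A D) (Val (Fobj F j) A))"
    using rep representable_iff[OF presheaf_Hom(1)[OF \<iota>]] by blast
  then obtain d e where de: "\<And>j. j \<in> Obj J \<Longrightarrow> d j \<in> Obj C" "\<And>j. j \<in> Obj J \<Longrightarrow> e j \<in> Val (Fobj F j) (d j)"
    "\<And>j A. j \<in> Obj J \<Longrightarrow> A \<in> Obj C \<Longrightarrow>
      bij_betw (\<lambda>g. Act (Fobj F j) g (e j)) (Hom C A (d j)) (Val (Fobj F j) A)"
    by metis
  let ?G = "(\<lambda>j. (d j, component (\<iota> j) (d j) (e j))) ` Obj J"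
  show ?thesis
  proof (rule that)
    show "small \<kappa> ?G" by (rule small_image[OF sJ])
    show "D \<in> Obj C \<and> x \<in> Val P D" if "(D, x) \<in> ?G" for D x
      using that de(1,2) component_in[OF \<iota>] by auto
    fix A x assume A: "A \<in> Obj C" and x: "x \<in> Val P A"
    obtain j y where j: "j \<in> Obj J" and y: "y \<in> Val (Fobj F j) A" and x_eq: "component (\<iota> j) A y = x"
      by (rule pointwise_colimit_surj[OF pointwise_if_colimit[OF cJ F L] A x])
    obtain g where g: "g \<in> Hom C A (d j)" and y_eq: "y = Act (Fobj F j) g (e j)"
      using de(3)[OF j A] y unfolding bij_betw_def by blast
    have "x = Act P g (component (\<iota> j) (d j) (e j))"
      using component_natural[OF \<iota>[OF j] g de(2)[OF j]] x_eq y_eq by simp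
    then show "\<exists>(D, e) \<in> ?G. \<exists>g \<in> Hom C A D. x = Act P g e" using g j by auto
  qed
qed

section \<open>Subpresheaves\<close>

definition subpresheaf :: "('o, 'a) psh \<Rightarrow> ('o \<Rightarrow> 'a set) \<Rightarrow> ('o, 'a) psh" where
  "subpresheaf P T = psh_of C T (Act P)"

definition stable_subset :: "('o, 'a) psh \<Rightarrow> ('o \<Rightarrow> 'a set) \<Rightarrow> bool" where
  "stable_subset P T \<longleftrightarrow> (\<forall>A \<in> Obj C. T A \<subseteq> Val P A) \<and>
     (\<forall>f A B x. f \<in> Hom C A B \<longrightarrow> x \<in> T B \<longrightarrow> Act P f x \<in> T A)"

lemma Val_subpresheaf: "A \<in> Obj C \<Longrightarrow> Val (subpresheaf P T) A = T A"
  by (simp add: subpresheaf_def Val_psh_of)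

lemma Act_subpresheaf: "f \<in> Hom C A B \<Longrightarrow> x \<in> T B \<Longrightarrow> Act (subpresheaf P T) f x = Act P f x"
  by (simp add: subpresheaf_def Act_psh_of)

lemma presheaf_subpresheaf:
  assumes P: "presheaf \<kappa> C P" and T: "stable_subset P T"
  shows "presheaf \<kappa> C (subpresheaf P T)"
  unfolding subpresheaf_def
proof (rule presheaf_psh_of)
  have sub: "x \<in> Val P A" if "A \<in> Obj C" "x \<in> T A" for A x
    using T that unfolding stable_subset_def by blast
  show "small \<kappa> (T A)" if "A \<in> Obj C" for A
    using small_Val[OF P that] sub that by (blast intro: small_subset)
  show "Act P f x \<in> T A" if "f \<in> Hom C A B" "x \<in> T B" for f A B x
    using T that unfolding stable_subset_def by blast
  show "Act P (Ident C A) x = x" if "A \<in> Obj C" "x \<in> T A" for A x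
    by (rule Act_Ident[OF P sub[OF that] that(1)])
  show "Act P (Comp C g f) x = Act P f (Act P g x)"
    if "f \<in> Hom C A B" "g \<in> Hom C B D" "x \<in> T D" for f g A B D x
    by (rule Act_Comp[OF P that(1,2) sub[OF Hom_Obj(2)[OF that(2)] that(3)]])
qed

lemma restriction_in_Hom:
  assumes \<tau>: "\<tau> \<in> Hom PSh P Q" and T: "stable_subset P T" and U: "stable_subset Q U"
    and TU: "\<And>A x. A \<in> Obj C \<Longrightarrow> x \<in> T A \<Longrightarrow> component \<tau> A x \<in> U A"
  shows "transformation C (subpresheaf P T) (subpresheaf Q U) (component \<tau>)
    \<in> Hom PSh (subpresheaf P T) (subpresheaf Q U)"
proof (rule transformation_in_Hom[OF presheaf_subpresheaf[OF _ T] presheaf_subpresheaf[OF _ U]])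
  show "presheaf \<kappa> C P" "presheaf \<kappa> C Q" using presheaf_Hom[OF \<tau>] .
  show "component \<tau> A x \<in> Val (subpresheaf Q U) A"
    if "A \<in> Obj C" "x \<in> Val (subpresheaf P T) A" for A x
    using TU that by (simp add: Val_subpresheaf)
  show "component \<tau> A (Act (subpresheaf P T) f x) = Act (subpresheaf Q U) f (component \<tau> B x)"
    if f: "f \<in> Hom C A B" and x: "x \<in> Val (subpresheaf P T) B" for f A B x
  proof -
    have B: "B \<in> Obj C" using Hom_Obj[OF f] by simp
    have xT: "x \<in> T B" using x B by (simp add: Val_subpresheaf)
    then have "x \<in> Val P B" using T B unfolding stable_subset_def by blast
    then show ?thesis
      using component_natural[OF \<tau> f] Act_subpresheaf[where T = T and P = P, OF f xT]
        Act_subpresheaf[where T = U and P = Q, OF f TU[OF B xT]] by simp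
  qed
qed

text \<open>
  If \<open>P\<close> is represented by \<open>D\<close> with universal element \<open>e\<close>, its subpresheaves are the sieves on \<open>D\<close>. A
  sieve generated by a single monic \<open>m\<close> is represented by the domain of \<open>m\<close>, with the restriction
  of \<open>e\<close> along \<open>m\<close> as universal element.
\<close>

lemma representable_subpresheaf:
  assumes P: "presheaf \<kappa> C P" and T: "stable_subset P T"
    and D: "D \<in> Obj C" and e: "e \<in> Val P D"
    and bij: "\<And>A. A \<in> Obj C \<Longrightarrow> bij_betw (\<lambda>g. Act P g e) (Hom C A D) (Val P A)"
    and m: "monic C m" "Cod C m = D"
    and T_iff: "\<And>A g. g \<in> Hom C A D \<Longrightarrow>
      Act P g e \<in> T A \<longleftrightarrow> (\<exists>k \<in> Hom C A (Dom C m). Comp C m k = g)"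
  shows "representable \<kappa> C (subpresheaf P T)"
proof -
  have mH: "m \<in> Hom C (Dom C m) D" using m by (simp add: monic_def in_Hom_iff)
  have E: "Dom C m \<in> Obj C" using Hom_Obj[OF mH] by simp
  let ?e = "Act P m e"
  have eT: "?e \<in> T (Dom C m)"
    using T_iff[OF mH] Ident_in[OF E] Comp_Ident[OF mH] by blast
  have act: "Act (subpresheaf P T) k ?e = Act P (Comp C m k) e" if "k \<in> Hom C A (Dom C m)" for A k
    using Act_subpresheaf[where T = T and P = P, OF that eT] Act_Comp[OF P that mH e] by simp
  have "bij_betw (\<lambda>k. Act (subpresheaf P T) k ?e) (Hom C A (Dom C m)) (Val (subpresheaf P T) A)"
    if A: "A \<in> Obj C" for A
    unfolding bij_betw_def
  proof (intro conjI inj_onI equalityI subsetI)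
    fix k k' assume k: "k \<in> Hom C A (Dom C m)" and k': "k' \<in> Hom C A (Dom C m)"
      and "Act (subpresheaf P T) k ?e = Act (subpresheaf P T) k' ?e"
    then have "Act P (Comp C m k) e = Act P (Comp C m k') e" using act by simp
    then have "Comp C m k = Comp C m k'"
      using bij[OF A] Comp_in[OF k mH] Comp_in[OF k' mH] by (meson bij_betw_def inj_onD)
    then show "k = k'" by (rule monicD[OF m(1) k k'])
  next
    fix y assume "y \<in> (\<lambda>k. Act (subpresheaf P T) k ?e) ` Hom C A (Dom C m)"
    then obtain k where k: "k \<in> Hom C A (Dom C m)" "y = Act P (Comp C m k) e" using act by auto
    then show "y \<in> Val (subpresheaf P T) A"
      using T_iff[OF Comp_in[OF k(1) mH]] A by (auto simp: Val_subpresheaf)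
  next
    fix y assume "y \<in> Val (subpresheaf P T) A"
    then have y: "y \<in> T A" using A by (simp add: Val_subpresheaf)
    then have "y \<in> Val P A" using T A unfolding stable_subset_def by blast
    then obtain g where g: "g \<in> Hom C A D" "y = Act P g e"
      using bij[OF A] unfolding bij_betw_def by blast
    then obtain k where "k \<in> Hom C A (Dom C m)" "Comp C m k = g" using T_iff y by blast
    then show "y \<in> (\<lambda>k. Act (subpresheaf P T) k ?e) ` Hom C A (Dom C m)"
      using g act by force
  qed
  then show ?thesis
    unfolding representable_iff[OF presheaf_subpresheaf[OF P T]]
    using E eT by (intro bexI[of _ "Dom C m"] bexI[of _ ?e]) (auto simp: Val_subpresheaf)
qed

text \<open>
  Membership in the preimages \<open>T'\<close> is invariant under the diagram. Hence an invariant predicate on the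
  restricted diagram, conjoined with membership, is an invariant predicate on the full diagram, and
  the elementwise description of the colimit restricts to \<open>T\<close>.
\<close>

lemma colimit_subpresheaf:
  assumes J: "category J" and F: "is_functor J PSh F" and L: "is_colimit J PSh F R \<iota>"
    and T: "stable_subset R T"
  defines "T' \<equiv> \<lambda>j A. {y \<in> Val (Fobj F j) A. component (\<iota> j) A y \<in> T A}"
  defines "F' \<equiv> \<lparr>Fobj = (\<lambda>j. subpresheaf (Fobj F j) (T' j)),
    Farr = (\<lambda>u. transformation C (subpresheaf (Fobj F (Dom J u)) (T' (Dom J u)))
      (subpresheaf (Fobj F (Cod J u)) (T' (Cod J u))) (component (Farr F u)))\<rparr>"
  defines "\<iota>' \<equiv> \<lambda>j. transformation C (subpresheaf (Fobj F j) (T' j)) (subpresheaf R T) (component (\<iota> j))"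
  shows "\<And>j. j \<in> Obj J \<Longrightarrow> stable_subset (Fobj F j) (T' j)"
    and "is_functor J PSh F'" and "is_colimit J PSh F' (subpresheaf R T) \<iota>'"
proof -
  have c: "is_cocone J PSh F R \<iota>" using L by (simp add: is_colimit_def)
  then have R: "presheaf \<kappa> C R" by (simp add: is_cocone_def presheaves_def)
  have \<iota>: "\<iota> j \<in> Hom PSh (Fobj F j) R" if "j \<in> Obj J" for j
    using that c by (auto simp: is_cocone_def)
  have Fu: "Farr F u \<in> Hom PSh (Fobj F (Dom J u)) (Fobj F (Cod J u))" if "u \<in> Arr J" for u
    using F that by (simp add: is_functor_def)
  have FI: "Farr F (Ident J j) = Ident PSh (Fobj F j)" if "j \<in> Obj J" for j
    using F that by (simp add: is_functor_def)
  have FC: "Farr F (Comp J v u) = Comp PSh (Farr F v) (Farr F u)"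
    if "u \<in> Arr J" "v \<in> Arr J" "Dom J v = Cod J u" for u v
    using F that by (simp add: is_functor_def)
  have \<iota>F: "component (\<iota> (Cod J u)) A (component (Farr F u) A y) = component (\<iota> (Dom J u)) A y"
    if "u \<in> Arr J" "A \<in> Obj C" "y \<in> Val (Fobj F (Dom J u)) A" for u A y
  proof -
    have "Comp PSh (\<iota> (Cod J u)) (Farr F u) = \<iota> (Dom J u)" using c that by (simp add: is_cocone_def)
    then show ?thesis using component_Comp[OF Fu[OF that(1)] that(2,3)] by metis
  qed
  have Tact: "Act R f x \<in> T A" if "f \<in> Hom C A B" "x \<in> T B" for f A B x
    using T that unfolding stable_subset_def by blast
  show st: "stable_subset (Fobj F j) (T' j)" if j: "j \<in> Obj J" for j
    using Act_in[OF presheaf_Hom(1)[OF \<iota>[OF j]]] component_natural[OF \<iota>[OF j]] Tact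
    unfolding stable_subset_def T'_def by auto
  have psh: "presheaf \<kappa> C (subpresheaf (Fobj F j) (T' j))" if j: "j \<in> Obj J" for j
    by (rule presheaf_subpresheaf[OF presheaf_Hom(1)[OF \<iota>[OF j]] st[OF j]])
  have mem: "y \<in> Val (Fobj F j) A" "component (\<iota> j) A y \<in> T A"
    if "A \<in> Obj C" "y \<in> Val (Fobj F' j) A" for A j y
    using that by (auto simp: F'_def T'_def Val_subpresheaf)
  have memI: "y \<in> Val (Fobj F' j) A"
    if "A \<in> Obj C" "y \<in> Val (Fobj F j) A" "component (\<iota> j) A y \<in> T A" for A j y
    using that by (auto simp: F'_def T'_def Val_subpresheaf)
  have F'u: "Farr F' u \<in> Hom PSh (Fobj F' (Dom J u)) (Fobj F' (Cod J u))" if u: "u \<in> Arr J" for u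
    unfolding F'_def functr.simps
    using component_in[OF Fu[OF u]] \<iota>F[OF u]
    by (intro restriction_in_Hom[OF Fu[OF u] st st] category.Dom_in[OF J u] category.Cod_in[OF J u])
      (auto simp: T'_def)
  have F'c: "component (Farr F' u) A y = component (Farr F u) A y"
    if "A \<in> Obj C" "y \<in> Val (Fobj F' (Dom J u)) A" for u A y
    using that by (simp add: F'_def component_transformation)
  have \<iota>': "\<iota>' j \<in> Hom PSh (Fobj F' j) (subpresheaf R T)" if j: "j \<in> Obj J" for j
    unfolding F'_def functr.simps \<iota>'_def
    by (intro restriction_in_Hom[OF \<iota>[OF j] st[OF j] T]) (auto simp: T'_def)
  have \<iota>'c: "component (\<iota>' j) A y = component (\<iota> j) A y"
    if "A \<in> Obj C" "y \<in> Val (Fobj F' j) A" for j A y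
    using that by (simp add: F'_def \<iota>'_def component_transformation)
  show F': "is_functor J PSh F'"
    unfolding is_functor_def
  proof (intro conjI ballI impI)
    show "Fobj F' j \<in> Obj PSh" if "j \<in> Obj J" for j
      using psh[OF that] by (simp add: F'_def presheaves_def)
    show "Farr F' u \<in> Hom PSh (Fobj F' (Dom J u)) (Fobj F' (Cod J u))" if "u \<in> Arr J" for u
      by (rule F'u[OF that])
    show "Farr F' (Ident J j) = Ident PSh (Fobj F' j)" if j: "j \<in> Obj J" for j
    proof -
      note Ij = category.Ident_Arr[OF J j]
      show ?thesis
      proof (rule PSh_eqI)
        show "Farr F' (Ident J j) \<in> Hom PSh (Fobj F' j) (Fobj F' j)" using F'u[of "Ident J j"] Ij by simp
        show "Ident PSh (Fobj F' j) \<in> Hom PSh (Fobj F' j) (Fobj F' j)"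
          using psh[OF j] by (intro Ident_PSh_in) (simp add: F'_def)
        show "component (Farr F' (Ident J j)) A x = component (Ident PSh (Fobj F' j)) A x"
          if "A \<in> Obj C" "x \<in> Val (Fobj F' j) A" for A x
          using that F'c[of A x "Ident J j"] Ij FI[OF j] mem[OF that] by (simp add: component_Ident)
      qed
    qed
    show "Farr F' (Comp J v u) = Comp PSh (Farr F' v) (Farr F' u)"
      if u: "u \<in> Arr J" and v: "v \<in> Arr J" and vu: "Dom J v = Cod J u" for u v
    proof (rule PSh_eqI)
      note c = category.Comp_Arr[OF J u v vu]
      have v': "Farr F' v \<in> Hom PSh (Fobj F' (Cod J u)) (Fobj F' (Cod J v))" using F'u[OF v] vu by simp
      show "Farr F' (Comp J v u) \<in> Hom PSh (Fobj F' (Dom J u)) (Fobj F' (Cod J v))"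
        using F'u[of "Comp J v u"] c by simp
      show "Comp PSh (Farr F' v) (Farr F' u) \<in> Hom PSh (Fobj F' (Dom J u)) (Fobj F' (Cod J v))"
        by (rule Comp_PSh_in[OF F'u[OF u] v'])
      fix A x assume A: "A \<in> Obj C" and x: "x \<in> Val (Fobj F' (Dom J u)) A"
      have x': "component (Farr F' u) A x \<in> Val (Fobj F' (Dom J v)) A"
        using component_in[OF F'u[OF u] A x] vu by simp
      have "component (Farr F' (Comp J v u)) A x = component (Farr F (Comp J v u)) A x"
        using F'c[OF A, of x "Comp J v u"] x c by simp
      also have "\<dots> = component (Farr F v) A (component (Farr F u) A x)"
        using FC[OF u v vu] component_Comp[OF Fu[OF u] A mem(1)[OF A x]] by simp
      also have "\<dots> = component (Farr F' v) A (component (Farr F' u) A x)"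
        using F'c[OF A x] F'c[OF A x'] by simp
      also have "\<dots> = component (Comp PSh (Farr F' v) (Farr F' u)) A x"
        using component_Comp[OF F'u[OF u] A x] by simp
      finally show "component (Farr F' (Comp J v u)) A x =
        component (Comp PSh (Farr F' v) (Farr F' u)) A x" .
    qed
  qed
  have c': "is_cocone J PSh F' (subpresheaf R T) \<iota>'"
    unfolding is_cocone_def
  proof (intro conjI ballI)
    show "subpresheaf R T \<in> Obj PSh" using presheaf_subpresheaf[OF R T] by (simp add: presheaves_def)
    show "\<iota>' j \<in> Hom PSh (Fobj F' j) (subpresheaf R T)" if "j \<in> Obj J" for j by (rule \<iota>'[OF that])
    show "Comp PSh (\<iota>' (Cod J u)) (Farr F' u) = \<iota>' (Dom J u)" if u: "u \<in> Arr J" for u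
    proof (rule PSh_eqI[OF Comp_PSh_in[OF F'u[OF u] \<iota>'] \<iota>'])
      show "Cod J u \<in> Obj J" "Dom J u \<in> Obj J"
        using category.Dom_in[OF J u] category.Cod_in[OF J u] by auto
      fix A y assume A: "A \<in> Obj C" and y: "y \<in> Val (Fobj F' (Dom J u)) A"
      show "component (Comp PSh (\<iota>' (Cod J u)) (Farr F' u)) A y = component (\<iota>' (Dom J u)) A y"
        using component_Comp[OF F'u[OF u] A y] \<iota>'c[OF A component_in[OF F'u[OF u] A y]]
          F'c[OF A y] \<iota>'c[OF A y] \<iota>F[OF u A mem(1)[OF A y]] by simp
    qed
  qed
  have pw: "pointwise_colimit C J F R \<iota>" by (rule pointwise_if_colimit[OF J F L])
  have "pointwise_colimit C J F' (subpresheaf R T) \<iota>'"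
    unfolding pointwise_colimit_def
  proof (intro ballI conjI allI impI)
    fix A x assume A: "A \<in> Obj C" and "x \<in> Val (subpresheaf R T) A"
    then have xT: "x \<in> T A" by (simp add: Val_subpresheaf)
    then have "x \<in> Val R A" using T A unfolding stable_subset_def by blast
    then obtain j y where j: "j \<in> Obj J" and y: "y \<in> Val (Fobj F j) A" and x: "component (\<iota> j) A y = x"
      by (rule pointwise_colimit_surj[OF pw A])
    have y': "y \<in> Val (Fobj F' j) A" using memI[OF A y] x xT by simp
    show "\<exists>j \<in> Obj J. \<exists>y \<in> Val (Fobj F' j) A. component (\<iota>' j) A y = x"
      using j y' \<iota>'c[OF A y'] x by auto
  next
    fix A W j j' y y'
    assume A: "A \<in> Obj C"
      and W: "\<forall>u \<in> Arr J. \<forall>y \<in> Val (Fobj F' (Dom J u)) A.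
        W (Dom J u) y \<longleftrightarrow> W (Cod J u) (component (Farr F' u) A y)"
      and j: "j \<in> Obj J" "j' \<in> Obj J" and y: "y \<in> Val (Fobj F' j) A" "y' \<in> Val (Fobj F' j') A"
      and eq: "component (\<iota>' j) A y = component (\<iota>' j') A y'" and Wy: "W j y"
    \<comment> \<open>off the preimages \<open>W\<close> is unconstrained, so membership is added to make it invariant\<close>
    let ?W = "\<lambda>i z. component (\<iota> i) A z \<in> T A \<and> W i z"
    have "?W j' y'"
    proof (rule pointwise_colimit_invariant[OF pw A, where T = ?W and j = j and y = y])
      fix u z assume u: "u \<in> Arr J" and z: "z \<in> Val (Fobj F (Dom J u)) A"
      show "?W (Dom J u) z \<longleftrightarrow> ?W (Cod J u) (component (Farr F u) A z)"
      proof (cases "component (\<iota> (Dom J u)) A z \<in> T A")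
        case True
        then have "z \<in> Val (Fobj F' (Dom J u)) A" by (rule memI[OF A z])
        then show ?thesis using W u F'c[OF A] \<iota>F[OF u A z] by metis
      next
        case False
        then show ?thesis using \<iota>F[OF u A z] by simp
      qed
    qed (use j mem[OF A] y eq \<iota>'c[OF A] Wy in auto)
    then show "W j' y'" by simp
  qed
  then show "is_colimit J PSh F' (subpresheaf R T) \<iota>'"
    by (rule colimit_if_pointwise[OF J F' c'])
qed

text \<open>
  The hypothesis \<open>pb\<close> says that the pullback of the subpresheaf along any map from a representable is
  again representable, by a monic. Then so are the preimages in a diagram of representables.
\<close>

lemma small_subpresheaf:
  assumes R: "small_presheaf \<kappa> C R" and T: "stable_subset R T"
    and pb: "\<And>D r. D \<in> Obj C \<Longrightarrow> r \<in> Val R D \<Longrightarrow> \<exists>m. monic C m \<and> Cod C m = D \<and>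
      (\<forall>A g. g \<in> Hom C A D \<longrightarrow> (Act R g r \<in> T A \<longleftrightarrow> (\<exists>k \<in> Hom C A (Dom C m). Comp C m k = g)))"
  shows "small_presheaf \<kappa> C (subpresheaf R T)"
proof -
  obtain J :: "('a, 'a) cat" and F \<iota> where J: "small_category \<kappa> J" and F: "is_functor J PSh F"
    and rep: "\<forall>j \<in> Obj J. representable \<kappa> C (Fobj F j)" and L: "is_colimit J PSh F R \<iota>"
    using R unfolding small_presheaf_def by blast
  have cJ: "category J" using J by (simp add: small_category_def)
  have \<iota>: "\<iota> j \<in> Hom PSh (Fobj F j) R" if "j \<in> Obj J" for j
    using that L by (auto simp: is_colimit_def is_cocone_def)
  define T' where "T' j A = {y \<in> Val (Fobj F j) A. component (\<iota> j) A y \<in> T A}" for j A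
  note sub = colimit_subpresheaf[OF cJ F L T, folded T'_def]
  have "representable \<kappa> C (subpresheaf (Fobj F j) (T' j))" if j: "j \<in> Obj J" for j
  proof -
    have P: "presheaf \<kappa> C (Fobj F j)" by (rule presheaf_Hom(1)[OF \<iota>[OF j]])
    obtain D e where D: "D \<in> Obj C" and e: "e \<in> Val (Fobj F j) D"
      and bij: "\<And>A. A \<in> Obj C \<Longrightarrow> bij_betw (\<lambda>g. Act (Fobj F j) g e) (Hom C A D) (Val (Fobj F j) A)"
      using iffD1[OF representable_iff[OF P] bspec[OF rep j]] by blast
    obtain m where m: "monic C m" "Cod C m = D"
      and m_iff: "\<And>A g. g \<in> Hom C A D \<Longrightarrow> Act R g (component (\<iota> j) D e) \<in> T A \<longleftrightarrow>
        (\<exists>k \<in> Hom C A (Dom C m). Comp C m k = g)"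
      using pb[OF D component_in[OF \<iota>[OF j] D e]] by blast
    show ?thesis
    proof (rule representable_subpresheaf[OF P sub(1)[OF j] D e bij m])
      fix A g assume g: "g \<in> Hom C A D"
      have "Act (Fobj F j) g e \<in> T' j A \<longleftrightarrow> Act R g (component (\<iota> j) D e) \<in> T A"
        using Act_in[OF P g e] component_natural[OF \<iota>[OF j] g e] by (simp add: T'_def)
      then show "Act (Fobj F j) g e \<in> T' j A \<longleftrightarrow> (\<exists>k\<in>Hom C A (Dom C m). Comp C m k = g)"
        using m_iff[OF g] by simp
    qed auto
  qed
  then have "\<forall>j \<in> Obj J. representable \<kappa> C
      (Fobj \<lparr>Fobj = (\<lambda>j. subpresheaf (Fobj F j) (T' j)),
        Farr = (\<lambda>u. transformation C (subpresheaf (Fobj F (Dom J u)) (T' (Dom J u)))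
          (subpresheaf (Fobj F (Cod J u)) (T' (Cod J u))) (component (Farr F u)))\<rparr> j)"
    by simp
  then show ?thesis using J sub(2,3) unfolding small_presheaf_def T'_def by blast
qed

section \<open>The category of small presheaves\<close>

abbreviation SP where "SP \<equiv> small_presheaves \<kappa> C"

lemma Comp_SP: "Comp SP = Comp PSh" and Ident_SP: "Ident SP = Ident PSh"
  and Dom_SP: "Dom SP = Dom PSh" and Cod_SP: "Cod SP = Cod PSh"
  by (simp_all add: small_presheaves_def full_subcategory_def)

lemma in_Hom_SP: "\<mu> \<in> Hom SP P Q \<longleftrightarrow> small_presheaf \<kappa> C P \<and> small_presheaf \<kappa> C Q \<and> \<mu> \<in> Hom PSh P Q"
  by (auto simp: Hom_def small_presheaves_def full_subcategory_def)

lemma Obj_SP: "P \<in> Obj SP \<longleftrightarrow> small_presheaf \<kappa> C P"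
  using presheaf_small_presheaf by (auto simp: small_presheaves_def full_subcategory_def presheaves_def)

lemma Arr_SP: "\<mu> \<in> Arr SP \<longleftrightarrow> \<mu> \<in> Hom SP (Dom SP \<mu>) (Cod SP \<mu>)"
  by (auto simp: Hom_def)

lemma Hom_SP_D: "\<mu> \<in> Hom SP P Q \<Longrightarrow> \<mu> \<in> Hom PSh P Q"
  by (simp add: in_Hom_SP)

lemma Hom_SP_ends: "\<mu> \<in> Hom SP P Q \<Longrightarrow> Dom SP \<mu> = P" "\<mu> \<in> Hom SP P Q \<Longrightarrow> Cod SP \<mu> = Q"
  by (simp_all add: Hom_def)

lemma category_SP: "category SP"
proof
  show "Dom SP f \<in> Obj SP" "Cod SP f \<in> Obj SP" if "f \<in> Arr SP" for f
    using that unfolding Arr_SP in_Hom_SP Obj_SP by auto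
  show "Ident SP P \<in> Hom SP P P" if "P \<in> Obj SP" for P
    using that Ident_PSh_in presheaf_small_presheaf by (simp add: in_Hom_SP Obj_SP Ident_SP)
  show "Comp SP g f \<in> Hom SP P R" if "f \<in> Hom SP P Q" "g \<in> Hom SP Q R" for f g P Q R
    using that PSh.Comp_in[of f P Q g R] by (simp add: in_Hom_SP Comp_SP)
  show "Comp SP f (Ident SP P) = f" "Comp SP (Ident SP Q) f = f" if "f \<in> Hom SP P Q" for f P Q
    using that PSh.Comp_Ident[of f P Q] PSh.Ident_Comp[of f P Q]
    by (simp_all add: in_Hom_SP Comp_SP Ident_SP)
  show "Comp SP h (Comp SP g f) = Comp SP (Comp SP h g) f"
    if "f \<in> Hom SP P Q" "g \<in> Hom SP Q R" "h \<in> Hom SP R S" for f g h P Q R S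
    using that PSh.Comp_assoc[of f P Q g R h S] by (simp add: in_Hom_SP Comp_SP)
qed

sublocale SP: category SP by (rule category_SP)

lemma isomorphism_SP_iff:
  assumes i: "i \<in> Hom SP P Q"
  shows "isomorphism SP i \<longleftrightarrow> (\<forall>A \<in> Obj C. bij_betw (component i A) (Val P A) (Val Q A))"
proof -
  have "isomorphism SP i \<longleftrightarrow> isomorphism PSh i"
    using i SP.isomorphism_iff[OF i] PSh.isomorphism_iff[OF Hom_SP_D[OF i]]
    by (auto simp: in_Hom_SP Comp_SP Ident_SP)
  then show ?thesis using isomorphism_PSh_iff[OF Hom_SP_D[OF i]] by simp
qed

text \<open>
  A transformation out of \<open>P\<close> is determined by its values on a small set of generators of \<open>P\<close>.
\<close>

lemma locally_small_category_SP: "locally_small_category \<kappa> SP"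
  unfolding locally_small_category_def
proof (intro conjI ballI category_SP)
  fix P Q assume P: "P \<in> Obj SP" and Q: "Q \<in> Obj SP"
  obtain G where G: "small \<kappa> G" "\<And>D e. (D, e) \<in> G \<Longrightarrow> D \<in> Obj C \<and> e \<in> Val P D"
    "\<And>A x. A \<in> Obj C \<Longrightarrow> x \<in> Val P A \<Longrightarrow> \<exists>(D, e) \<in> G. \<exists>g \<in> Hom C A D. x = Act P g e"
    using small_presheaf_generators P unfolding Obj_SP by blast
  have psh: "presheaf \<kappa> C Q" using Q presheaf_small_presheaf by (simp add: Obj_SP)
  define \<phi> :: "('o, 'a) psh_arr \<Rightarrow> 'o \<times> 'a \<Rightarrow> 'a" where
    "\<phi> \<mu> = (\<lambda>(D, e) \<in> G. component \<mu> D e)" for \<mu>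
  show "small \<kappa> (Hom SP P Q)"
  proof (rule small_inj[where f = \<phi>])
    show "small \<kappa> (\<Pi>\<^sub>E (D, e) \<in> G. Val Q D)"
      using G(2) small_Val[OF psh] by (intro small_PiE[OF universe G(1)]) auto
    show "\<phi> ` Hom SP P Q \<subseteq> (\<Pi>\<^sub>E (D, e) \<in> G. Val Q D)"
    proof (rule image_subsetI)
      fix \<mu> assume \<mu>: "\<mu> \<in> Hom SP P Q"
      show "\<phi> \<mu> \<in> (\<Pi>\<^sub>E (D, e) \<in> G. Val Q D)"
        using G(2) component_in[OF Hom_SP_D[OF \<mu>]] by (auto simp: \<phi>_def)
    qed
    show "inj_on \<phi> (Hom SP P Q)"
    proof (rule inj_onI)
      fix \<mu> \<nu> assume \<mu>: "\<mu> \<in> Hom SP P Q" and \<nu>: "\<nu> \<in> Hom SP P Q" and eq: "\<phi> \<mu> = \<phi> \<nu>"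
      have on_G: "component \<mu> D e = component \<nu> D e" if "(D, e) \<in> G" for D e
        using fun_cong[OF eq, of "(D, e)"] that by (simp add: \<phi>_def)
      show "\<mu> = \<nu>"
      proof (rule PSh_eqI[OF Hom_SP_D[OF \<mu>] Hom_SP_D[OF \<nu>]])
        fix A x assume "A \<in> Obj C" "x \<in> Val P A"
        then obtain D e g where De: "(D, e) \<in> G" and g: "g \<in> Hom C A D" and x: "x = Act P g e"
          using G(3) by blast
        then have "e \<in> Val P D" using G(2) by blast
        then show "component \<mu> A x = component \<nu> A x"
          using component_natural[OF Hom_SP_D[OF \<mu>] g] component_natural[OF Hom_SP_D[OF \<nu>] g]
            on_G[OF De] x by simp
      qed
    qed
  qed
qed

section \<open>Pullbacks of small presheaves\<close>

lemma from_element_in_SP: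
  assumes "small_presheaf \<kappa> C P" "A \<in> Obj C" "x \<in> Val P A"
  shows "from_element P A x \<in> Hom SP (Y A) P"
  using assms from_element_in small_presheaf_Y presheaf_small_presheaf by (simp add: in_Hom_SP)

lemma Comp_from_element:
  assumes \<tau>: "\<tau> \<in> Hom SP P Q" and A: "A \<in> Obj C" and x: "x \<in> Val P A"
  shows "Comp SP \<tau> (from_element P A x) = from_element Q A (component \<tau> A x)"
proof -
  have sp: "small_presheaf \<kappa> C P" "small_presheaf \<kappa> C Q" using \<tau> by (auto simp: in_Hom_SP)
  have \<gamma>: "from_element P A x \<in> Hom SP (Y A) P" by (rule from_element_in_SP[OF sp(1) A x])
  have \<gamma>': "from_element Q A (component \<tau> A x) \<in> Hom SP (Y A) Q"
    by (rule from_element_in_SP[OF sp(2) A component_in[OF Hom_SP_D[OF \<tau>] A x]])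
  show ?thesis
  proof (rule PSh_eqI[OF Hom_SP_D[OF SP.Comp_in[OF \<gamma> \<tau>]] Hom_SP_D[OF \<gamma>']])
    fix B g assume B: "B \<in> Obj C" and "g \<in> Val (Y A) B"
    then have g: "g \<in> Hom C B A" by (simp add: Val_Y)
    show "component (Comp SP \<tau> (from_element P A x)) B g =
        component (from_element Q A (component \<tau> A x)) B g"
      using component_Comp[OF Hom_SP_D[OF \<gamma>] B, of g \<tau>] g B
        component_natural[OF Hom_SP_D[OF \<tau>] g x]
      by (simp add: Comp_SP Val_Y component_from_element)
  qed
qed

lemma from_element_Ident: "A \<in> Obj C \<Longrightarrow> small_presheaf \<kappa> C P \<Longrightarrow> x \<in> Val P A \<Longrightarrow>
    component (from_element P A x) A (Ident C A) = x"
  using component_from_element[OF Ident_in] Act_Ident[OF presheaf_small_presheaf] by simp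

text \<open>
  One direction tests the universal property against representables, whose maps are elements; these
  are small presheaves, so the test is possible within the category.
\<close>

lemma is_pullback_SP_iff:
  assumes m: "m \<in> Hom SP P Q" and f: "f \<in> Hom SP R Q" and p: "p \<in> Hom SP S R" and q: "q \<in> Hom SP S P"
  shows "is_pullback SP m f p q \<longleftrightarrow> (\<forall>A \<in> Obj C.
    (\<forall>s \<in> Val S A. component f A (component p A s) = component m A (component q A s)) \<and>
    (\<forall>r \<in> Val R A. \<forall>x \<in> Val P A. component f A r = component m A x \<longrightarrow>
      (\<exists>!s. s \<in> Val S A \<and> component p A s = r \<and> component q A s = x)))"
    (is "_ \<longleftrightarrow> ?pw")
proof
  note P = Hom_SP_D[OF p] and Q = Hom_SP_D[OF q] and M = Hom_SP_D[OF m] and F = Hom_SP_D[OF f]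
  have sp: "small_presheaf \<kappa> C P" "small_presheaf \<kappa> C R" "small_presheaf \<kappa> C S"
    using p q by (auto simp: in_Hom_SP)
  assume pb: "is_pullback SP m f p q"
  then have fp: "Comp PSh f p = Comp PSh m q" by (simp add: is_pullback_def Comp_SP)
  have univ: "\<exists>!h. h \<in> Hom SP X S \<and> Comp SP p h = u \<and> Comp SP q h = v"
    if "u \<in> Hom SP X R" "v \<in> Hom SP X P" "Comp SP f u = Comp SP m v" for X u v
    using pb that SP.Hom_Obj(1)[OF that(1)] Hom_SP_ends[OF p] Hom_SP_ends[OF f] Hom_SP_ends[OF m]
      Hom_SP_ends[OF q]
    by (simp add: is_pullback_def)
  show ?pw
  proof (intro ballI conjI impI)
    fix A s assume "A \<in> Obj C" "s \<in> Val S A"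
    then show "component f A (component p A s) = component m A (component q A s)"
      using component_Comp[OF P, of A s f] component_Comp[OF Q, of A s m] fp by simp
  next
    fix A r x assume A: "A \<in> Obj C" and r: "r \<in> Val R A" and x: "x \<in> Val P A"
      and eq: "component f A r = component m A x"
    let ?u = "from_element R A r" and ?v = "from_element P A x"
    have u: "?u \<in> Hom SP (Y A) R" and v: "?v \<in> Hom SP (Y A) P"
      using from_element_in_SP A r x sp by auto
    have uv: "Comp SP f ?u = Comp SP m ?v"
      using Comp_from_element[OF f A r] Comp_from_element[OF m A x] eq by simp
    obtain h where h: "h \<in> Hom SP (Y A) S" "Comp SP p h = ?u" "Comp SP q h = ?v"
      and h_unique: "\<And>k. k \<in> Hom SP (Y A) S \<Longrightarrow> Comp SP p k = ?u \<Longrightarrow> Comp SP q k = ?v \<Longrightarrow> k = h"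
      using univ[OF u v uv] by blast
    let ?s = "component h A (Ident C A)"
    have s: "?s \<in> Val S A" by (rule yoneda_element_in[OF Hom_SP_D[OF h(1)] A])
    have I: "Ident C A \<in> Val (Y A) A" using Ident_in[OF A] A by (simp add: Val_Y)
    show "\<exists>!s. s \<in> Val S A \<and> component p A s = r \<and> component q A s = x"
    proof (rule ex1I)
      show "?s \<in> Val S A \<and> component p A ?s = r \<and> component q A ?s = x"
        using s component_Comp[OF Hom_SP_D[OF h(1)] A I, of p] component_Comp[OF Hom_SP_D[OF h(1)] A I, of q]
          h(2,3) from_element_Ident[OF A sp(2) r] from_element_Ident[OF A sp(1) x]
        by (simp add: Comp_SP)
      fix s' assume s': "s' \<in> Val S A \<and> component p A s' = r \<and> component q A s' = x"
      then have "from_element S A s' = h"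
        using Comp_from_element[OF p A] Comp_from_element[OF q A] from_element_in_SP[OF sp(3) A]
        by (intro h_unique) auto
      then show "s' = ?s" using from_element_Ident[OF A sp(3)] s' by metis
    qed
  qed
next
  note P = Hom_SP_D[OF p] and Q = Hom_SP_D[OF q] and M = Hom_SP_D[OF m] and F = Hom_SP_D[OF f]
  assume pw: ?pw
  have sq: "component f A (component p A s) = component m A (component q A s)"
    if "A \<in> Obj C" "s \<in> Val S A" for A s using pw that by blast
  have ex: "\<exists>!s. s \<in> Val S A \<and> component p A s = r \<and> component q A s = x"
    if "A \<in> Obj C" "r \<in> Val R A" "x \<in> Val P A" "component f A r = component m A x" for A r x
    using pw that by blast
  have "Comp PSh f p = Comp PSh m q"
    by (rule PSh_eqI[OF Comp_PSh_in[OF P F] Comp_PSh_in[OF Q M]])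
      (simp add: component_Comp[OF P] component_Comp[OF Q] sq)
  then have fp: "Comp SP f p = Comp SP m q" by (simp add: Comp_SP)
  have univ: "\<exists>!h. h \<in> Hom SP X S \<and> Comp SP p h = u \<and> Comp SP q h = v"
    if u: "u \<in> Hom SP X R" and v: "v \<in> Hom SP X P" and uv: "Comp SP f u = Comp SP m v" for X u v
  proof -
    note U = Hom_SP_D[OF u] and V = Hom_SP_D[OF v]
    define t where "t A z = (THE s. s \<in> Val S A \<and> component p A s = component u A z \<and>
      component q A s = component v A z)" for A z
    have ex': "\<exists>!s. s \<in> Val S A \<and> component p A s = component u A z \<and> component q A s = component v A z"
      if A: "A \<in> Obj C" and z: "z \<in> Val X A" for A z
    proof (rule ex[OF A component_in[OF U A z] component_in[OF V A z]])
      show "component f A (component u A z) = component m A (component v A z)"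
        using component_Comp[OF U A z, of f] component_Comp[OF V A z, of m] uv by (simp add: Comp_SP)
    qed
    have t: "t A z \<in> Val S A" "component p A (t A z) = component u A z"
        "component q A (t A z) = component v A z"
      if "A \<in> Obj C" "z \<in> Val X A" for A z
      using theI'[OF ex'[OF that]] unfolding t_def by auto
    have t_unique: "s = t A z" if "A \<in> Obj C" "z \<in> Val X A" "s \<in> Val S A"
      "component p A s = component u A z" "component q A s = component v A z" for A z s
      unfolding t_def by (rule the1_equality[symmetric, OF ex'[OF that(1,2)]]) (use that in simp)
    let ?h = "transformation C X S t"
    have h: "?h \<in> Hom PSh X S"
    proof (rule transformation_in_Hom[OF presheaf_Hom(1)[OF U] presheaf_Hom(1)[OF P] t(1)])
      fix g A B z assume g: "g \<in> Hom C A B" and z: "z \<in> Val X B"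
      have A: "A \<in> Obj C" and B: "B \<in> Obj C" using Hom_Obj[OF g] by auto
      show "t A (Act X g z) = Act S g (t B z)"
        using component_natural[OF P g t(1)[OF B z]] component_natural[OF Q g t(1)[OF B z]]
          component_natural[OF U g z] component_natural[OF V g z] t(2,3)[OF B z]
          Act_in[OF presheaf_Hom(1)[OF P] g t(1)[OF B z]] Act_in[OF presheaf_Hom(1)[OF U] g z]
        by (intro t_unique[OF A, symmetric]) auto
    qed auto
    have h': "?h \<in> Hom SP X S" using h u p by (simp add: in_Hom_SP)
    show ?thesis
    proof (rule ex1I)
      have "Comp PSh p ?h = u"
        by (rule PSh_eqI[OF Comp_PSh_in[OF h P] U])
          (simp add: component_Comp[OF h] component_transformation t)
      moreover have "Comp PSh q ?h = v"
        by (rule PSh_eqI[OF Comp_PSh_in[OF h Q] V])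
          (simp add: component_Comp[OF h] component_transformation t)
      ultimately show "?h \<in> Hom SP X S \<and> Comp SP p ?h = u \<and> Comp SP q ?h = v"
        using h' by (simp add: Comp_SP)
      fix k assume k: "k \<in> Hom SP X S \<and> Comp SP p k = u \<and> Comp SP q k = v"
      then have K: "k \<in> Hom PSh X S" by (simp add: in_Hom_SP)
      show "k = ?h"
      proof (rule PSh_eqI[OF K h])
        fix A z assume A: "A \<in> Obj C" and z: "z \<in> Val X A"
        have "component k A z = t A z"
          using k component_Comp[OF K A z, of p] component_Comp[OF K A z, of q] component_in[OF K A z]
          by (intro t_unique[OF A z]) (auto simp: Comp_SP)
        then show "component k A z = component ?h A z" using A z by (simp add: component_transformation)
      qed
    qed
  qed
  have arrs: "m \<in> Arr SP" "f \<in> Arr SP" "p \<in> Arr SP" "q \<in> Arr SP"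
    using m f p q by (auto simp: Hom_def)
  show "is_pullback SP m f p q"
    unfolding is_pullback_def Hom_SP_ends[OF m] Hom_SP_ends[OF f] Hom_SP_ends[OF p] Hom_SP_ends[OF q]
    using arrs fp univ by blast
qed

text \<open>
  Pointwise, there is only one candidate for the factorization, and uniqueness makes it natural.
\<close>

lemma factor_through_injective:
  assumes \<mu>: "\<mu> \<in> Hom SP P Q" and \<nu>: "\<nu> \<in> Hom SP P' Q"
    and inj: "\<And>A. A \<in> Obj C \<Longrightarrow> inj_on (component \<nu> A) (Val P' A)"
    and sub: "\<And>A. A \<in> Obj C \<Longrightarrow> component \<mu> A ` Val P A \<subseteq> component \<nu> A ` Val P' A"
  obtains h where "h \<in> Hom SP P P'" "Comp SP \<nu> h = \<mu>"
proof -
  note M = Hom_SP_D[OF \<mu>] and N = Hom_SP_D[OF \<nu>]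
  define t where "t A x = inv_into (Val P' A) (component \<nu> A) (component \<mu> A x)" for A x
  have t: "t A x \<in> Val P' A" "component \<nu> A (t A x) = component \<mu> A x"
    if "A \<in> Obj C" "x \<in> Val P A" for A x
    using sub[OF that(1)] that(2) unfolding t_def by (auto intro!: inv_into_into f_inv_into_f)
  let ?h = "transformation C P P' t"
  have h: "?h \<in> Hom PSh P P'"
  proof (rule transformation_in_Hom[OF presheaf_Hom(1)[OF M] presheaf_Hom(1)[OF N] t(1)])
    fix g A B x assume g: "g \<in> Hom C A B" and x: "x \<in> Val P B"
    have A: "A \<in> Obj C" and B: "B \<in> Obj C" using Hom_Obj[OF g] by auto
    have gx: "Act P g x \<in> Val P A" by (rule Act_in[OF presheaf_Hom(1)[OF M] g x])
    have gt: "Act P' g (t B x) \<in> Val P' A" by (rule Act_in[OF presheaf_Hom(1)[OF N] g t(1)[OF B x]])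
    have "component \<nu> A (t A (Act P g x)) = component \<nu> A (Act P' g (t B x))"
      using t(2)[OF A gx] t(2)[OF B x] component_natural[OF M g x] component_natural[OF N g t(1)[OF B x]]
      by simp
    then show "t A (Act P g x) = Act P' g (t B x)"
      using inj_onD[OF inj[OF A]] t(1)[OF A gx] gt by blast
  qed auto
  moreover have "Comp PSh \<nu> ?h = \<mu>"
    by (rule PSh_eqI[OF Comp_PSh_in[OF h N] M])
      (simp add: component_Comp[OF h] component_transformation t)
  ultimately show ?thesis using that \<mu> \<nu> by (simp add: in_Hom_SP Comp_SP)
qed

end

section \<open>Monics of small presheaves\<close>

locale locally_small_M = locally_small C \<kappa> for C :: "('o, 'a) cat" and \<kappa> :: "'a rel" +
  fixes M :: "'a set"
  assumes stable: "stable_system C M"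
    and well_powered: "M_well_powered \<kappa> C M"
begin

abbreviation PM where "PM \<equiv> presheaf_monics \<kappa> C M"

text \<open>
  The pullback of \<open>\<mu>: P \<Rightarrow> Q\<close> along the map from the representable at \<open>D\<close> given by \<open>q\<close> is, for injective \<open>\<mu>\<close>,
  a sieve on \<open>D\<close>; the definition says that \<open>m\<close> generates it.
\<close>

definition preimage_at :: "('o, 'a) psh \<Rightarrow> ('o, 'a) psh \<Rightarrow> ('o, 'a) psh_arr \<Rightarrow> 'o \<Rightarrow> 'a \<Rightarrow> 'a \<Rightarrow> bool" where
  "preimage_at P Q \<mu> D q m \<longleftrightarrow> Cod C m = D \<and> (\<forall>A g. g \<in> Hom C A D \<longrightarrow>
     (Act Q g q \<in> component \<mu> A ` Val P A \<longleftrightarrow> (\<exists>k \<in> Hom C A (Dom C m). Comp C m k = g)))"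

lemma monic_M: "m \<in> M \<Longrightarrow> monic C m"
  using stable by (simp add: stable_system_def)

lemma Hom_M: "m \<in> M \<Longrightarrow> m \<in> Hom C (Dom C m) (Cod C m)"
  using monic_M by (simp add: monic_def in_Hom_iff)

lemma preimage_atD:
  "preimage_at P Q \<mu> D q m \<Longrightarrow> g \<in> Hom C A D \<Longrightarrow>
    Act Q g q \<in> component \<mu> A ` Val P A \<longleftrightarrow> (\<exists>k \<in> Hom C A (Dom C m). Comp C m k = g)"
  by (simp add: preimage_at_def)

lemma yoneda_arr_in_SP: "m \<in> Hom C A B \<Longrightarrow> yoneda_arr C m \<in> Hom SP (Y A) (Y B)"
  using yoneda_arr_in small_presheaf_Y Hom_Obj by (simp add: in_Hom_SP)

text \<open>
  The defining pullback square of a distinguished monic at \<open>q\<close>, read off elementwise.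
\<close>

lemma presheaf_monics_pullback:
  assumes \<mu>: "\<mu> \<in> Hom SP P Q" and PM: "\<mu> \<in> PM" and D: "D \<in> Obj C" and q: "q \<in> Val Q D"
  obtains m \<delta> where "m \<in> M" "Cod C m = D" "\<delta> \<in> Hom SP (Y (Dom C m)) P"
    "\<And>A k. k \<in> Hom C A (Dom C m) \<Longrightarrow> Act Q (Comp C m k) q = component \<mu> A (component \<delta> A k)"
    "\<And>A g x. g \<in> Hom C A D \<Longrightarrow> x \<in> Val P A \<Longrightarrow> Act Q g q = component \<mu> A x \<Longrightarrow>
      \<exists>k \<in> Hom C A (Dom C m). Comp C m k = g \<and> component \<delta> A k = x"
proof -
  have spQ: "small_presheaf \<kappa> C Q" using \<mu> by (simp add: in_Hom_SP)
  have \<gamma>: "from_element Q D q \<in> Hom SP (Y D) Q" by (rule from_element_in_SP[OF spQ D q])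
  then obtain m \<delta> where m: "m \<in> M" "Cod C m = D"
    and pb: "is_pullback SP \<mu> (from_element Q D q) (yoneda_arr C m) \<delta>"
    using PM D Hom_SP_ends[OF \<mu>] unfolding presheaf_monics_def by blast
  have mH: "m \<in> Hom C (Dom C m) D" using Hom_M[OF m(1)] m(2) by simp
  note ym = yoneda_arr_in_SP[OF mH]
  have \<delta>: "\<delta> \<in> Hom SP (Y (Dom C m)) P"
    using pb Hom_SP_ends[OF \<mu>] Hom_SP_ends[OF ym] by (simp add: is_pullback_def SP.in_Hom_iff)
  note pw = iffD1[OF is_pullback_SP_iff[OF \<mu> \<gamma> ym \<delta>] pb]
  show ?thesis
  proof (rule that[OF m \<delta>])
    fix A k assume k: "k \<in> Hom C A (Dom C m)"
    have A: "A \<in> Obj C" using Hom_Obj[OF k] by simp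
    have "component (from_element Q D q) A (component (yoneda_arr C m) A k) =
        component \<mu> A (component \<delta> A k)"
      using bspec[OF pw A, THEN conjunct1] k A by (simp add: Val_Y)
    then show "Act Q (Comp C m k) q = component \<mu> A (component \<delta> A k)"
      using component_yoneda_arr[OF mH k] component_from_element[OF Comp_in[OF k mH]] by simp
  next
    fix A g x assume g: "g \<in> Hom C A D" and x: "x \<in> Val P A" and eq: "Act Q g q = component \<mu> A x"
    have A: "A \<in> Obj C" using Hom_Obj[OF g] by simp
    have "\<exists>k. k \<in> Hom C A (Dom C m) \<and> component (yoneda_arr C m) A k = g \<and> component \<delta> A k = x"
      using bspec[OF bspec[OF bspec[OF pw A, THEN conjunct2], of g] x] g eq A
        component_from_element[OF g]
      by (auto simp: Val_Y)
    then show "\<exists>k \<in> Hom C A (Dom C m). Comp C m k = g \<and> component \<delta> A k = x"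
      using component_yoneda_arr[OF mH] by auto
  qed
qed

text \<open>
  Injectivity of \<open>\<mu>\<close> comes from pulling back along \<open>\<mu> x\<close>: elements with the same image as \<open>x\<close> correspond to
  sections of the monic \<open>m\<close> in the pullback, and a monic has at most one section. Conversely, if \<open>m\<close>
  generates the sieve of \<open>q\<close>, then the restriction of \<open>q\<close> along \<open>m\<close> has a preimage under \<open>\<mu>\<close>, and this gives
  the missing side of the pullback square.
\<close>

lemma presheaf_monics_iff:
  assumes \<mu>: "\<mu> \<in> Hom SP P Q"
  shows "\<mu> \<in> PM \<longleftrightarrow> (\<forall>A \<in> Obj C. inj_on (component \<mu> A) (Val P A)) \<and>
    (\<forall>D \<in> Obj C. \<forall>q \<in> Val Q D. \<exists>m \<in> M. preimage_at P Q \<mu> D q m)"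
proof
  have sp: "small_presheaf \<kappa> C P" "small_presheaf \<kappa> C Q" using \<mu> by (auto simp: in_Hom_SP)
  note Q = presheaf_small_presheaf[OF sp(2)]
  assume PM: "\<mu> \<in> PM"
  have "inj_on (component \<mu> A) (Val P A)" if A: "A \<in> Obj C" for A
  proof (rule inj_onI)
    fix x x' assume x: "x \<in> Val P A" and x': "x' \<in> Val P A"
      and eq: "component \<mu> A x = component \<mu> A x'"
    have q: "component \<mu> A x \<in> Val Q A" by (rule component_in[OF Hom_SP_D[OF \<mu>] A x])
    obtain m \<delta> where m: "m \<in> M" and lift: "\<And>x'. x' \<in> Val P A \<Longrightarrow>
        Act Q (Ident C A) (component \<mu> A x) = component \<mu> A x' \<Longrightarrow>
        \<exists>k \<in> Hom C A (Dom C m). Comp C m k = Ident C A \<and> component \<delta> A k = x'"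
      by (rule presheaf_monics_pullback[OF \<mu> PM A q]) (use Ident_in[OF A] in blast)
    have I: "Act Q (Ident C A) (component \<mu> A x) = component \<mu> A x" by (rule Act_Ident[OF Q q A])
    obtain k where k: "k \<in> Hom C A (Dom C m)" "Comp C m k = Ident C A" "component \<delta> A k = x"
      using lift[OF x I] by blast
    obtain k' where k': "k' \<in> Hom C A (Dom C m)" "Comp C m k' = Ident C A" "component \<delta> A k' = x'"
      using lift[OF x'] I eq by auto
    have "k = k'" using monicD[OF monic_M[OF m] k(1) k'(1)] k(2) k'(2) by simp
    then show "x = x'" using k(3) k'(3) by simp
  qed
  moreover have "\<exists>m \<in> M. preimage_at P Q \<mu> D q m" if D: "D \<in> Obj C" and q: "q \<in> Val Q D" for D q
  proof -
    obtain m \<delta> where m: "m \<in> M" "Cod C m = D" and \<delta>: "\<delta> \<in> Hom SP (Y (Dom C m)) P"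
      and sq: "\<And>A k. k \<in> Hom C A (Dom C m) \<Longrightarrow> Act Q (Comp C m k) q = component \<mu> A (component \<delta> A k)"
      and lift: "\<And>A g x. g \<in> Hom C A D \<Longrightarrow> x \<in> Val P A \<Longrightarrow> Act Q g q = component \<mu> A x \<Longrightarrow>
        \<exists>k \<in> Hom C A (Dom C m). Comp C m k = g \<and> component \<delta> A k = x"
      by (rule presheaf_monics_pullback[OF \<mu> PM D q]) blast
    have "Act Q g q \<in> component \<mu> A ` Val P A \<longleftrightarrow> (\<exists>k \<in> Hom C A (Dom C m). Comp C m k = g)"
      if g: "g \<in> Hom C A D" for A g
    proof
      show "\<exists>k \<in> Hom C A (Dom C m). Comp C m k = g" if "Act Q g q \<in> component \<mu> A ` Val P A"
        using that lift[OF g] by blast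
      assume "\<exists>k \<in> Hom C A (Dom C m). Comp C m k = g"
      then obtain k where k: "k \<in> Hom C A (Dom C m)" "Comp C m k = g" by blast
      have A: "A \<in> Obj C" using Hom_Obj[OF g] by simp
      have "component \<delta> A k \<in> Val P A"
        using component_in[OF Hom_SP_D[OF \<delta>] A] k A by (simp add: Val_Y)
      then show "Act Q g q \<in> component \<mu> A ` Val P A" using sq[OF k(1)] k(2) by blast
    qed
    then show ?thesis using m unfolding preimage_at_def by blast
  qed
  ultimately show "(\<forall>A \<in> Obj C. inj_on (component \<mu> A) (Val P A)) \<and>
    (\<forall>D \<in> Obj C. \<forall>q \<in> Val Q D. \<exists>m \<in> M. preimage_at P Q \<mu> D q m)" by blast
next
  have sp: "small_presheaf \<kappa> C P" "small_presheaf \<kappa> C Q" using \<mu> by (auto simp: in_Hom_SP)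
  note P = presheaf_small_presheaf[OF sp(1)] and Q = presheaf_small_presheaf[OF sp(2)]
  assume *: "(\<forall>A \<in> Obj C. inj_on (component \<mu> A) (Val P A)) \<and>
    (\<forall>D \<in> Obj C. \<forall>q \<in> Val Q D. \<exists>m \<in> M. preimage_at P Q \<mu> D q m)"
  have "\<exists>m \<in> M. \<exists>\<delta>. Cod C m = D \<and> is_pullback SP \<mu> \<gamma> (yoneda_arr C m) \<delta>"
    if D: "D \<in> Obj C" and \<gamma>: "\<gamma> \<in> Hom SP (Y D) Q" for D \<gamma>
  proof -
    define q where "q = component \<gamma> D (Ident C D)"
    have q: "q \<in> Val Q D" unfolding q_def by (rule yoneda_element_in[OF Hom_SP_D[OF \<gamma>] D])
    have \<gamma>q: "component \<gamma> A g = Act Q g q" if "g \<in> Hom C A D" for A g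
      unfolding q_def by (rule yoneda[OF Hom_SP_D[OF \<gamma>] that])
    obtain m where m: "m \<in> M" and pre: "preimage_at P Q \<mu> D q m" using * D q by blast
    have mD: "Cod C m = D" using pre by (simp add: preimage_at_def)
    have mH: "m \<in> Hom C (Dom C m) D" using Hom_M[OF m] mD by simp
    have E: "Dom C m \<in> Obj C" using Hom_Obj[OF mH] by simp
    obtain p where p: "p \<in> Val P (Dom C m)" "component \<mu> (Dom C m) p = Act Q m q"
      using preimage_atD[OF pre mH] Ident_in[OF E] Comp_Ident[OF mH] by (metis imageE)
    let ?\<delta> = "from_element P (Dom C m) p"
    have \<delta>: "?\<delta> \<in> Hom SP (Y (Dom C m)) P" by (rule from_element_in_SP[OF sp(1) E p(1)])
    have sq: "Act Q (Comp C m k) q = component \<mu> A (Act P k p)" if k: "k \<in> Hom C A (Dom C m)" for A k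
      using Act_Comp[OF Q k mH q] component_natural[OF Hom_SP_D[OF \<mu>] k p(1)] p(2) by simp
    have "is_pullback SP \<mu> \<gamma> (yoneda_arr C m) ?\<delta>"
      unfolding is_pullback_SP_iff[OF \<mu> \<gamma> yoneda_arr_in_SP[OF mH] \<delta>]
    proof (intro ballI conjI impI)
      fix A k assume A: "A \<in> Obj C" and "k \<in> Val (Y (Dom C m)) A"
      then have k: "k \<in> Hom C A (Dom C m)" by (simp add: Val_Y)
      show "component \<gamma> A (component (yoneda_arr C m) A k) = component \<mu> A (component ?\<delta> A k)"
        using component_yoneda_arr[OF mH k] \<gamma>q[OF Comp_in[OF k mH]] sq[OF k] component_from_element[OF k]
        by simp
    next
      fix A g x assume A: "A \<in> Obj C" and "g \<in> Val (Y D) A" and x: "x \<in> Val P A"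
        and eq: "component \<gamma> A g = component \<mu> A x"
      then have g: "g \<in> Hom C A D" by (simp add: Val_Y)
      have gq: "Act Q g q = component \<mu> A x" using eq \<gamma>q[OF g] by simp
      then obtain k where k: "k \<in> Hom C A (Dom C m)" "Comp C m k = g"
        using preimage_atD[OF pre g] x by blast
      have "component \<mu> A (Act P k p) = component \<mu> A x" using sq[OF k(1)] k(2) gq by simp
      then have kx: "Act P k p = x"
        using * A inj_onD[of "component \<mu> A" "Val P A"] Act_in[OF P k(1) p(1)] x by blast
      show "\<exists>!k. k \<in> Val (Y (Dom C m)) A \<and> component (yoneda_arr C m) A k = g \<and> component ?\<delta> A k = x"
      proof (rule ex1I)
        show "k \<in> Val (Y (Dom C m)) A \<and> component (yoneda_arr C m) A k = g \<and> component ?\<delta> A k = x"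
          using k kx A component_yoneda_arr[OF mH k(1)] component_from_element[OF k(1)]
          by (simp add: Val_Y)
        fix k' assume k': "k' \<in> Val (Y (Dom C m)) A \<and> component (yoneda_arr C m) A k' = g \<and>
          component ?\<delta> A k' = x"
        then have "k' \<in> Hom C A (Dom C m)" using A by (simp add: Val_Y)
        then show "k' = k"
          using monicD[OF monic_M[OF m], of k' A k] k k' component_yoneda_arr[OF mH, of k' A] by simp
      qed
    qed
    then show ?thesis using m mD by blast
  qed
  moreover have "\<mu> \<in> Arr SP" using \<mu> by (simp add: SP.in_Hom_iff)
  ultimately show "\<mu> \<in> PM" using Hom_SP_ends[OF \<mu>] by (simp add: presheaf_monics_def)
qed

lemma PM_Hom: "\<mu> \<in> PM \<Longrightarrow> \<mu> \<in> Hom SP (Dom SP \<mu>) (Cod SP \<mu>)"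
  by (simp add: presheaf_monics_def SP.in_Hom_iff)

lemma PM_inj:
  "\<mu> \<in> PM \<Longrightarrow> \<mu> \<in> Hom SP P Q \<Longrightarrow> A \<in> Obj C \<Longrightarrow> inj_on (component \<mu> A) (Val P A)"
  using presheaf_monics_iff by blast

lemma PM_preimage:
  assumes "\<mu> \<in> PM" "\<mu> \<in> Hom SP P Q" "D \<in> Obj C" "q \<in> Val Q D"
  obtains m where "m \<in> M" "preimage_at P Q \<mu> D q m"
  using assms presheaf_monics_iff by blast

lemma monic_PM:
  assumes "\<mu> \<in> PM"
  shows "monic SP \<mu>"
  unfolding monic_def
proof (intro conjI ballI impI)
  note \<mu> = PM_Hom[OF assms]
  show "\<mu> \<in> Arr SP" using \<mu> by (simp add: SP.in_Hom_iff)
  fix X f g assume f: "f \<in> Hom SP X (Dom SP \<mu>)" and g: "g \<in> Hom SP X (Dom SP \<mu>)"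
    and eq: "Comp SP \<mu> f = Comp SP \<mu> g"
  show "f = g"
  proof (rule PSh_eqI[OF Hom_SP_D[OF f] Hom_SP_D[OF g]])
    fix A x assume A: "A \<in> Obj C" and x: "x \<in> Val X A"
    have "component \<mu> A (component f A x) = component \<mu> A (component g A x)"
      using component_Comp[OF Hom_SP_D[OF f] A x, of \<mu>] component_Comp[OF Hom_SP_D[OF g] A x, of \<mu>] eq
      by (simp add: Comp_SP)
    then show "component f A x = component g A x"
      using inj_onD[OF PM_inj[OF assms \<mu> A]] component_in[OF Hom_SP_D[OF f] A x]
        component_in[OF Hom_SP_D[OF g] A x] by blast
  qed
qed

text \<open>
  The sieve of an element in the image is everything, generated by an identity.
\<close>

lemma isomorphism_PM:
  assumes "isomorphism SP i"
  shows "i \<in> PM"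
proof -
  have i: "i \<in> Hom SP (Dom SP i) (Cod SP i)" using assms by (simp add: isomorphism_def SP.in_Hom_iff)
  have bij: "bij_betw (component i A) (Val (Dom SP i) A) (Val (Cod SP i) A)" if "A \<in> Obj C" for A
    using assms that isomorphism_SP_iff[OF i] by blast
  show ?thesis
    unfolding presheaf_monics_iff[OF i]
  proof (intro conjI ballI)
    show "inj_on (component i A) (Val (Dom SP i) A)" if "A \<in> Obj C" for A
      using bij[OF that] by (simp add: bij_betw_def)
    fix D q assume D: "D \<in> Obj C" and q: "q \<in> Val (Cod SP i) D"
    have "Ident C D \<in> M"
      using stable isomorphism_Ident[OF D] by (simp add: stable_system_def)
    moreover have "preimage_at (Dom SP i) (Cod SP i) i D q (Ident C D)"
      unfolding preimage_at_def
    proof (intro conjI allI impI)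
      show "Cod C (Ident C D) = D" using Ident_Arr[OF D] by simp
      fix A g assume g: "g \<in> Hom C A D"
      have A: "A \<in> Obj C" using Hom_Obj[OF g] by simp
      have "Act (Cod SP i) g q \<in> component i A ` Val (Dom SP i) A"
        using bij[OF A] Act_in[OF presheaf_Hom(2)[OF Hom_SP_D[OF i]] g q] by (simp add: bij_betw_def)
      then show "Act (Cod SP i) g q \<in> component i A ` Val (Dom SP i) A \<longleftrightarrow>
          (\<exists>k \<in> Hom C A (Dom C (Ident C D)). Comp C (Ident C D) k = g)"
        using g Ident_Comp[OF g] Ident_Arr[OF D] by auto
    qed
    ultimately show "\<exists>m \<in> M. preimage_at (Dom SP i) (Cod SP i) i D q m" by blast
  qed
qed

text \<open>
  If \<open>m\<close> generates the sieve of \<open>r\<close> for \<open>\<nu>\<close>, the restriction of \<open>r\<close> along \<open>m\<close> is \<open>\<nu> q\<close> for a unique \<open>q\<close>. If \<open>n\<close>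
  generates the sieve of \<open>q\<close> for \<open>\<mu>\<close>, then \<open>m \<circ> n\<close> generates that of \<open>r\<close> for the composite.
\<close>

lemma Comp_PM:
  assumes "\<mu> \<in> PM" "\<nu> \<in> PM" "Dom SP \<nu> = Cod SP \<mu>"
  shows "Comp SP \<nu> \<mu> \<in> PM"
proof -
  obtain P Q R where \<mu>: "\<mu> \<in> Hom SP P Q" and \<nu>: "\<nu> \<in> Hom SP Q R"
    using PM_Hom[OF assms(1)] PM_Hom[OF assms(2)] assms(3) by metis
  note \<mu>' = Hom_SP_D[OF \<mu>] and \<nu>' = Hom_SP_D[OF \<nu>]
  note Q = presheaf_Hom(1)[OF \<nu>'] and R = presheaf_Hom(2)[OF \<nu>']
  have c: "component (Comp SP \<nu> \<mu>) A x = component \<nu> A (component \<mu> A x)"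
    if "A \<in> Obj C" "x \<in> Val P A" for A x
    using component_Comp[OF \<mu>' that] by (simp add: Comp_SP)
  show ?thesis
    unfolding presheaf_monics_iff[OF SP.Comp_in[OF \<mu> \<nu>]]
  proof (intro conjI ballI)
    fix A assume A: "A \<in> Obj C"
    show "inj_on (component (Comp SP \<nu> \<mu>) A) (Val P A)"
    proof (rule inj_onI)
      fix x y assume x: "x \<in> Val P A" and y: "y \<in> Val P A"
        and "component (Comp SP \<nu> \<mu>) A x = component (Comp SP \<nu> \<mu>) A y"
      then have "component \<nu> A (component \<mu> A x) = component \<nu> A (component \<mu> A y)" using c[OF A] by simp
      then have "component \<mu> A x = component \<mu> A y"
        using inj_onD[OF PM_inj[OF assms(2) \<nu> A]] component_in[OF \<mu>' A x] component_in[OF \<mu>' A y] by blast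
      then show "x = y" using inj_onD[OF PM_inj[OF assms(1) \<mu> A]] x y by blast
    qed
  next
    fix D r assume D: "D \<in> Obj C" and r: "r \<in> Val R D"
    obtain m where m: "m \<in> M" "preimage_at Q R \<nu> D r m"
      by (rule PM_preimage[OF assms(2) \<nu> D r])
    have mH: "m \<in> Hom C (Dom C m) D" using Hom_M[OF m(1)] m(2) by (simp add: preimage_at_def)
    have E: "Dom C m \<in> Obj C" using Hom_Obj[OF mH] by simp
    obtain q where q: "q \<in> Val Q (Dom C m)" "component \<nu> (Dom C m) q = Act R m r"
      using preimage_atD[OF m(2) mH] Ident_in[OF E] Comp_Ident[OF mH] by (metis imageE)
    obtain n where n: "n \<in> M" "preimage_at P Q \<mu> (Dom C m) q n"
      by (rule PM_preimage[OF assms(1) \<mu> E q(1)])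
    have nH: "n \<in> Hom C (Dom C n) (Dom C m)" using Hom_M[OF n(1)] n(2) by (simp add: preimage_at_def)
    have mn: "Comp C m n \<in> Hom C (Dom C n) D" by (rule Comp_in[OF nH mH])
    have "Cod C n = Dom C m" using nH by (simp add: in_Hom_iff)
    then have "Comp C m n \<in> M" using stable m(1) n(1) by (simp add: stable_system_def)
    moreover have "preimage_at P R (Comp SP \<nu> \<mu>) D r (Comp C m n)"
      unfolding preimage_at_def
    proof (intro conjI allI impI)
      show "Cod C (Comp C m n) = D" using mn by (simp add: in_Hom_iff)
      fix A g assume g: "g \<in> Hom C A D"
      have A: "A \<in> Obj C" using Hom_Obj[OF g] by simp
      have lift: "Act R (Comp C m k) r = component \<nu> A (Act Q k q)" if k: "k \<in> Hom C A (Dom C m)" for k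
        using Act_Comp[OF R k mH r] component_natural[OF \<nu>' k q(1)] q(2) by simp
      show "Act R g r \<in> component (Comp SP \<nu> \<mu>) A ` Val P A \<longleftrightarrow>
          (\<exists>k \<in> Hom C A (Dom C (Comp C m n)). Comp C (Comp C m n) k = g)"
      proof
        assume "Act R g r \<in> component (Comp SP \<nu> \<mu>) A ` Val P A"
        then obtain x where x: "x \<in> Val P A" "Act R g r = component \<nu> A (component \<mu> A x)"
          using c[OF A] by auto
        note \<mu>x = component_in[OF \<mu>' A x(1)]
        obtain k where k: "k \<in> Hom C A (Dom C m)" "Comp C m k = g"
          using preimage_atD[OF m(2) g] x(2) \<mu>x by blast
        have "component \<nu> A (Act Q k q) = component \<nu> A (component \<mu> A x)"
          using lift[OF k(1)] k(2) x(2) by simp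
        then have "Act Q k q = component \<mu> A x"
          using inj_onD[OF PM_inj[OF assms(2) \<nu> A]] Act_in[OF Q k(1) q(1)] \<mu>x by blast
        then obtain l where l: "l \<in> Hom C A (Dom C n)" "Comp C n l = k"
          using preimage_atD[OF n(2) k(1)] x(1) by blast
        then have "Comp C (Comp C m n) l = g" using Comp_assoc[OF l(1) nH mH] k(2) by simp
        then show "\<exists>k \<in> Hom C A (Dom C (Comp C m n)). Comp C (Comp C m n) k = g"
          using l(1) mn by (auto simp: in_Hom_iff)
      next
        assume "\<exists>k \<in> Hom C A (Dom C (Comp C m n)). Comp C (Comp C m n) k = g"
        then obtain l where l: "l \<in> Hom C A (Dom C n)" "Comp C (Comp C m n) l = g"
          using mn by (auto simp: in_Hom_iff)
        have nl: "Comp C n l \<in> Hom C A (Dom C m)" by (rule Comp_in[OF l(1) nH])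
        obtain x where x: "x \<in> Val P A" "Act Q (Comp C n l) q = component \<mu> A x"
          using preimage_atD[OF n(2) nl] l(1) by blast
        have "Act R g r = component \<nu> A (component \<mu> A x)"
          using lift[OF nl] x(2) l(2) Comp_assoc[OF l(1) nH mH] by simp
        then show "Act R g r \<in> component (Comp SP \<nu> \<mu>) A ` Val P A" using c[OF A x(1)] x(1) by force
      qed
    qed
    ultimately show "\<exists>m \<in> M. preimage_at P R (Comp SP \<nu> \<mu>) D r m" by blast
  qed
qed

text \<open>
  The sieve of \<open>r\<close> for a pullback of \<open>\<mu>\<close> along \<open>f\<close> is the sieve of \<open>f r\<close> for \<open>\<mu>\<close>.
\<close>

lemma preimage_at_along:
  assumes f: "f \<in> Hom SP R Q" and D: "D \<in> Obj C" and r: "r \<in> Val R D"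
    and pre: "preimage_at P Q \<mu> D (component f D r) m" and g: "g \<in> Hom C A D"
  shows "component f A (Act R g r) \<in> component \<mu> A ` Val P A \<longleftrightarrow>
    (\<exists>k \<in> Hom C A (Dom C m). Comp C m k = g)"
  using preimage_atD[OF pre g] component_natural[OF Hom_SP_D[OF f] g r] by simp

text \<open>
  As \<open>\<mu>\<close> is injective, the pullback is the subpresheaf of \<open>R\<close> of elements sent into the image of \<open>\<mu>\<close>. It
  is small because its own pullbacks to representables are generated by single monics.
\<close>

lemma pullback_PM_exists:
  assumes \<mu>: "\<mu> \<in> Hom SP P Q" "\<mu> \<in> PM" and f: "f \<in> Hom SP R Q"
  shows "\<exists>p q. is_pullback SP \<mu> f p q"
proof -
  note \<mu>' = Hom_SP_D[OF \<mu>(1)] and f' = Hom_SP_D[OF f]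
  define T where "T A = {r \<in> Val R A. component f A r \<in> component \<mu> A ` Val P A}" for A
  have R: "small_presheaf \<kappa> C R" using f by (simp add: in_Hom_SP)
  note psh = presheaf_small_presheaf[OF R]
  have T: "stable_subset R T"
    unfolding stable_subset_def
  proof (intro conjI ballI allI impI)
    show "T A \<subseteq> Val R A" for A by (auto simp: T_def)
    fix g A B r assume g: "g \<in> Hom C A B" and "r \<in> T B"
    then obtain x where r: "r \<in> Val R B" and x: "x \<in> Val P B" "component f B r = component \<mu> B x"
      by (auto simp: T_def)
    have "component f A (Act R g r) = component \<mu> A (Act P g x)"
      using component_natural[OF f' g r] component_natural[OF \<mu>' g x(1)] x(2) by simp
    then show "Act R g r \<in> T A"
      using Act_in[OF psh g r] Act_in[OF presheaf_Hom(1)[OF \<mu>'] g x(1)] by (auto simp: T_def)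
  qed
  have "small_presheaf \<kappa> C (subpresheaf R T)"
  proof (rule small_subpresheaf[OF R T])
    fix D r assume D: "D \<in> Obj C" and r: "r \<in> Val R D"
    obtain m where m: "m \<in> M" "preimage_at P Q \<mu> D (component f D r) m"
      by (rule PM_preimage[OF \<mu>(2,1) D component_in[OF f' D r]])
    have "Act R g r \<in> T A \<longleftrightarrow> (\<exists>k \<in> Hom C A (Dom C m). Comp C m k = g)" if g: "g \<in> Hom C A D" for A g
      using preimage_at_along[OF f D r m(2) g] Act_in[OF psh g r] by (simp add: T_def)
    then show "\<exists>m. monic C m \<and> Cod C m = D \<and>
        (\<forall>A g. g \<in> Hom C A D \<longrightarrow> (Act R g r \<in> T A \<longleftrightarrow> (\<exists>k \<in> Hom C A (Dom C m). Comp C m k = g)))"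
      using m monic_M unfolding preimage_at_def by blast
  qed
  moreover define p where "p = transformation C (subpresheaf R T) R (\<lambda>A r. r)"
  have "p \<in> Hom PSh (subpresheaf R T) R"
    unfolding p_def
    by (rule transformation_in_Hom[OF presheaf_subpresheaf[OF psh T] psh])
      (auto simp: Val_subpresheaf T_def Hom_Obj(2) Act_subpresheaf[where T = T and P = R])
  ultimately have p: "p \<in> Hom SP (subpresheaf R T) R" using R by (simp add: in_Hom_SP)
  have pc: "component p A r = r" if "A \<in> Obj C" "r \<in> T A" for A r
    using that by (simp add: p_def component_transformation Val_subpresheaf)
  have fp: "component (Comp SP f p) A r = component f A r" if "A \<in> Obj C" "r \<in> T A" for A r
    using component_Comp[OF Hom_SP_D[OF p] that(1), of r f] pc[OF that] that
    by (simp add: Comp_SP Val_subpresheaf)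
  obtain q where q: "q \<in> Hom SP (subpresheaf R T) P" "Comp SP \<mu> q = Comp SP f p"
  proof (rule factor_through_injective[OF SP.Comp_in[OF p f] \<mu>(1)])
    show "inj_on (component \<mu> A) (Val P A)" if "A \<in> Obj C" for A by (rule PM_inj[OF \<mu>(2,1) that])
    show "component (Comp SP f p) A ` Val (subpresheaf R T) A \<subseteq> component \<mu> A ` Val P A"
      if "A \<in> Obj C" for A
      using fp[OF that] that by (auto simp: Val_subpresheaf T_def)
  qed
  have sq: "component f A r = component \<mu> A (component q A r)" if "A \<in> Obj C" "r \<in> T A" for A r
    using fp[OF that] q(2) component_Comp[OF Hom_SP_D[OF q(1)] that(1), of r \<mu>] that
    by (simp add: Comp_SP Val_subpresheaf)
  have "is_pullback SP \<mu> f p q"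
    unfolding is_pullback_SP_iff[OF \<mu>(1) f p q(1)]
  proof (intro ballI conjI impI)
    show "component f A (component p A s) = component \<mu> A (component q A s)"
      if "A \<in> Obj C" "s \<in> Val (subpresheaf R T) A" for A s
      using that sq[OF that(1)] pc[OF that(1)] by (simp add: Val_subpresheaf)
    fix A r x assume A: "A \<in> Obj C" and r: "r \<in> Val R A" and x: "x \<in> Val P A"
      and eq: "component f A r = component \<mu> A x"
    have rT: "r \<in> T A" using r x eq by (auto simp: T_def)
    have qr: "component q A r \<in> Val P A"
      using component_in[OF Hom_SP_D[OF q(1)] A] rT A by (simp add: Val_subpresheaf)
    have qx: "component q A r = x"
      using inj_onD[OF PM_inj[OF \<mu>(2,1) A]] sq[OF A rT] eq qr x by metis
    show "\<exists>!s. s \<in> Val (subpresheaf R T) A \<and> component p A s = r \<and> component q A s = x"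
    proof (rule ex1I)
      show "r \<in> Val (subpresheaf R T) A \<and> component p A r = r \<and> component q A r = x"
        using pc[OF A rT] rT A qx by (simp add: Val_subpresheaf)
      show "s = r" if "s \<in> Val (subpresheaf R T) A \<and> component p A s = r \<and> component q A s = x" for s
        using that pc[OF A, of s] A by (simp add: Val_subpresheaf)
    qed
  qed
  then show ?thesis by blast
qed

text \<open>
  Any pullback \<open>p\<close> is injective since \<open>\<mu>\<close> is, and its image consists of the elements that \<open>f\<close> sends into
  the image of \<open>\<mu>\<close>. So the monics in \<open>M\<close> that serve \<open>\<mu>\<close> at \<open>f r\<close> serve \<open>p\<close> at \<open>r\<close>.
\<close>

lemma pullback_PM:
  assumes \<mu>: "\<mu> \<in> Hom SP P Q" "\<mu> \<in> PM" and f: "f \<in> Hom SP R Q" and pb: "is_pullback SP \<mu> f p q"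
  shows "p \<in> PM"
proof -
  define S where "S = Dom SP p"
  have p: "p \<in> Hom SP S R" and q: "q \<in> Hom SP S P"
    using pb Hom_SP_ends[OF \<mu>(1)] Hom_SP_ends[OF f] by (auto simp: is_pullback_def SP.in_Hom_iff S_def)
  note pw = iffD1[OF is_pullback_SP_iff[OF \<mu>(1) f p q] pb]
  have sq: "component f A (component p A s) = component \<mu> A (component q A s)"
    if "A \<in> Obj C" "s \<in> Val S A" for A s using pw that by blast
  have ex: "\<exists>!s. s \<in> Val S A \<and> component p A s = r \<and> component q A s = x"
    if "A \<in> Obj C" "r \<in> Val R A" "x \<in> Val P A" "component f A r = component \<mu> A x" for A r x
    using pw that by blast
  note p' = component_in[OF Hom_SP_D[OF p]] and q' = component_in[OF Hom_SP_D[OF q]]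
  have R: "presheaf \<kappa> C R" by (rule presheaf_Hom(2)[OF Hom_SP_D[OF p]])
  have im: "r \<in> component p A ` Val S A \<longleftrightarrow> component f A r \<in> component \<mu> A ` Val P A"
    if A: "A \<in> Obj C" and r: "r \<in> Val R A" for A r
    using sq[OF A] q'[OF A] ex[OF A r] by (smt (verit) image_iff)
  show ?thesis
    unfolding presheaf_monics_iff[OF p]
  proof (intro conjI ballI)
    fix A assume A: "A \<in> Obj C"
    show "inj_on (component p A) (Val S A)"
    proof (rule inj_onI)
      fix s s' assume s: "s \<in> Val S A" and s': "s' \<in> Val S A" and eq: "component p A s = component p A s'"
      have "component \<mu> A (component q A s) = component \<mu> A (component q A s')"
        using sq[OF A s] sq[OF A s'] eq by simp
      then have "component q A s = component q A s'"
        using inj_onD[OF PM_inj[OF \<mu>(2,1) A]] q'[OF A s] q'[OF A s'] by blast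
      then show "s = s'" using ex[OF A p'[OF A s] q'[OF A s] sq[OF A s]] s s' eq by metis
    qed
  next
    fix D r assume D: "D \<in> Obj C" and r: "r \<in> Val R D"
    obtain m where m: "m \<in> M" "preimage_at P Q \<mu> D (component f D r) m"
      by (rule PM_preimage[OF \<mu>(2,1) D component_in[OF Hom_SP_D[OF f] D r]])
    have "Act R g r \<in> component p A ` Val S A \<longleftrightarrow> (\<exists>k \<in> Hom C A (Dom C m). Comp C m k = g)"
      if g: "g \<in> Hom C A D" for A g
      using preimage_at_along[OF f D r m(2) g] im[OF Hom_Obj(1)[OF g] Act_in[OF R g r]] by simp
    then show "\<exists>m \<in> M. preimage_at S R p D r m" using m unfolding preimage_at_def by blast
  qed
qed

lemma stable_system_PM: "stable_system SP PM"
  unfolding stable_system_def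
proof (intro conjI ballI allI impI)
  show "monic SP \<mu>" if "\<mu> \<in> PM" for \<mu> using monic_PM[OF that] .
  show "i \<in> PM" if "isomorphism SP i" for i using isomorphism_PM[OF that] .
  show "Comp SP \<nu> \<mu> \<in> PM" if "\<mu> \<in> PM" "\<nu> \<in> PM" "Dom SP \<nu> = Cod SP \<mu>" for \<mu> \<nu>
    using Comp_PM[OF that] .
  fix \<mu> f assume \<mu>: "\<mu> \<in> PM" and f: "f \<in> Arr SP" "Cod SP f = Cod SP \<mu>"
  have fH: "f \<in> Hom SP (Dom SP f) (Cod SP \<mu>)" using f by (simp add: SP.in_Hom_iff)
  show "\<exists>p q. is_pullback SP \<mu> f p q" by (rule pullback_PM_exists[OF PM_Hom[OF \<mu>] \<mu> fH])
  show "p \<in> PM" if "is_pullback SP \<mu> f p q" for p q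
    by (rule pullback_PM[OF PM_Hom[OF \<mu>] \<mu> fH that])
qed

section \<open>Well-poweredness\<close>

definition sieve :: "'a \<Rightarrow> 'a set" where
  "sieve m = Comp C m ` {k \<in> Arr C. Cod C k = Dom C m}"

lemma sieve_mono:
  assumes "(m, n) \<in> iso_over C M D"
  shows "sieve m \<subseteq> sieve n"
proof
  fix g assume "g \<in> sieve m"
  then obtain k where k: "k \<in> Hom C (Dom C k) (Dom C m)" "g = Comp C m k"
    by (auto simp: sieve_def in_Hom_iff)
  obtain i where n: "n \<in> M" and i: "i \<in> Hom C (Dom C m) (Dom C n)" "Comp C n i = m"
    using assms by (auto simp: iso_over_def)
  have "g = Comp C n (Comp C i k)" using Comp_assoc[OF k(1) i(1) Hom_M[OF n]] i(2) k(2) by simp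
  moreover have "Comp C i k \<in> Hom C (Dom C k) (Dom C n)" by (rule Comp_in[OF k(1) i(1)])
  ultimately show "g \<in> sieve n" by (auto simp: sieve_def in_Hom_iff)
qed

text \<open>
  Isomorphic monics generate the same sieve, so there are no more such sieves than subobjects.
\<close>

lemma small_sieves:
  assumes D: "D \<in> Obj C"
  shows "small \<kappa> (sieve ` {m \<in> M. Cod C m = D})"
proof (rule small_subset)
  let ?X = "{m \<in> M. Cod C m = D}"
  have eq: "equiv ?X (iso_over C M D)" using Hom_M by (intro equiv_iso_over) (auto simp: in_Hom_iff)
  have "small \<kappa> (M_subobjects C M D)" using well_powered D by (simp add: M_well_powered_def)
  then show "small \<kappa> ((\<lambda>U. \<Union>(sieve ` U)) ` M_subobjects C M D)" by (rule small_image)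
  show "sieve ` ?X \<subseteq> (\<lambda>U. \<Union>(sieve ` U)) ` M_subobjects C M D"
  proof (rule image_subsetI)
    fix m assume m: "m \<in> ?X"
    have un: "(\<Union>n \<in> iso_over C M D `` {m}. sieve n) = sieve m"
    proof (intro equalityI UN_least)
      fix n assume "n \<in> iso_over C M D `` {m}"
      then have "(n, m) \<in> iso_over C M D" using eq by (auto simp: equiv_def dest: symD)
      then show "sieve n \<subseteq> sieve m" by (rule sieve_mono)
    next
      show "sieve m \<subseteq> (\<Union>n \<in> iso_over C M D `` {m}. sieve n)"
        using equiv_class_self[OF eq m] by blast
    qed
    have "iso_over C M D `` {m} \<in> M_subobjects C M D"
      unfolding M_subobjects_def using m by (rule quotientI)
    then show "sieve m \<in> (\<lambda>U. \<Union>(sieve ` U)) ` M_subobjects C M D"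
      by (rule image_eqI[where f = "\<lambda>U. \<Union>(sieve ` U)", OF un[symmetric]])
  qed
qed

text \<open>
  Assign to a monic \<open>\<mu>\<close> into \<open>Q\<close> the family of sieves that it cuts out at a small set of generators of \<open>Q\<close>.
  These families form a small set, and each determines the image of \<open>\<mu>\<close>, because every
  element of \<open>Q\<close> is a restriction of a generator. Monics with the same image factor through each other.
\<close>

lemma well_powered_PM: "M_well_powered \<kappa> SP PM"
  unfolding M_well_powered_def
proof (intro ballI conjI)
  fix Q assume Q: "Q \<in> Obj SP"
  show "partial_order_on (M_subobjects SP PM Q) (M_subobject_order SP PM Q)"
    by (rule SP.partial_order_M_subobjects[OF monic_PM])
  obtain G where G: "small \<kappa> G" "\<And>D e. (D, e) \<in> G \<Longrightarrow> D \<in> Obj C \<and> e \<in> Val Q D"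
    "\<And>A x. A \<in> Obj C \<Longrightarrow> x \<in> Val Q A \<Longrightarrow> \<exists>(D, e) \<in> G. \<exists>g \<in> Hom C A D. x = Act Q g e"
    using small_presheaf_generators Q unfolding Obj_SP by blast
  define \<phi> :: "('o, 'a) psh_arr \<Rightarrow> 'o \<times> 'a \<Rightarrow> 'a set" where
    "\<phi> \<mu> = (\<lambda>(D, e) \<in> G. {g \<in> Arr C. Cod C g = D \<and>
      Act Q g e \<in> component \<mu> (Dom C g) ` Val (Dom SP \<mu>) (Dom C g)})" for \<mu>
  let ?X = "{\<mu> \<in> PM. Cod SP \<mu> = Q}"
  have PM_Arr: "PM \<subseteq> Arr SP" by (auto simp: presheaf_monics_def)
  show "small \<kappa> (M_subobjects SP PM Q)"
    unfolding M_subobjects_def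
  proof (rule small_quotient[OF SP.equiv_iso_over[OF PM_Arr], where f = \<phi>])
    show "small \<kappa> (\<phi> ` ?X)"
    proof (rule small_subset)
      show "small \<kappa> (\<Pi>\<^sub>E (D, e) \<in> G. sieve ` {m \<in> M. Cod C m = D})"
        using G(2) small_sieves by (intro small_PiE[OF universe G(1)]) auto
      show "\<phi> ` ?X \<subseteq> (\<Pi>\<^sub>E (D, e) \<in> G. sieve ` {m \<in> M. Cod C m = D})"
      proof (rule image_subsetI)
        fix \<mu> assume \<mu>: "\<mu> \<in> ?X"
        then have \<mu>H: "\<mu> \<in> Hom SP (Dom SP \<mu>) Q" using PM_Hom by blast
        have "{g \<in> Arr C. Cod C g = D \<and> Act Q g e \<in> component \<mu> (Dom C g) ` Val (Dom SP \<mu>) (Dom C g)}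
            \<in> sieve ` {m \<in> M. Cod C m = D}" if De: "(D, e) \<in> G" for D e
        proof -
          obtain m where m: "m \<in> M" "preimage_at (Dom SP \<mu>) Q \<mu> D e m"
            using PM_preimage[OF _ \<mu>H, of D e] \<mu> G(2)[OF De] by blast
          have mD: "Cod C m = D" using m(2) by (simp add: preimage_at_def)
          have mH: "m \<in> Hom C (Dom C m) D" using Hom_M[OF m(1)] mD by simp
          have "{g \<in> Arr C. Cod C g = D \<and> Act Q g e \<in> component \<mu> (Dom C g) ` Val (Dom SP \<mu>) (Dom C g)}
              = sieve m" (is "?L = _")
          proof (intro equalityI subsetI)
            fix g assume "g \<in> ?L"
            then show "g \<in> sieve m"
              using preimage_atD[OF m(2), of g "Dom C g"] by (auto simp: sieve_def in_Hom_iff)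
          next
            fix g assume "g \<in> sieve m"
            then obtain k where k: "k \<in> Hom C (Dom C k) (Dom C m)" "Comp C m k = g"
              by (auto simp: sieve_def in_Hom_iff)
            have g: "g \<in> Hom C (Dom C k) D" using Comp_in[OF k(1) mH] k(2) by simp
            then show "g \<in> ?L" using preimage_atD[OF m(2) g] k by (auto simp: in_Hom_iff)
          qed
          then show ?thesis using m mD by blast
        qed
        then show "\<phi> \<mu> \<in> (\<Pi>\<^sub>E (D, e) \<in> G. sieve ` {m \<in> M. Cod C m = D})"
          by (auto simp: \<phi>_def)
      qed
    qed
    fix \<mu> \<nu> assume \<mu>: "\<mu> \<in> ?X" and \<nu>: "\<nu> \<in> ?X" and eq: "\<phi> \<mu> = \<phi> \<nu>"
    have \<mu>H: "\<mu> \<in> Hom SP (Dom SP \<mu>) Q" and \<nu>H: "\<nu> \<in> Hom SP (Dom SP \<nu>) Q"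
      using \<mu> \<nu> PM_Hom[of \<mu>] PM_Hom[of \<nu>] by simp_all
    have sub: "component \<alpha> A ` Val (Dom SP \<alpha>) A \<subseteq> component \<beta> A ` Val (Dom SP \<beta>) A"
      if \<alpha>: "\<alpha> \<in> Hom SP (Dom SP \<alpha>) Q" and eq: "\<phi> \<alpha> = \<phi> \<beta>" and A: "A \<in> Obj C" for \<alpha> \<beta> A
    proof
      fix y assume y: "y \<in> component \<alpha> A ` Val (Dom SP \<alpha>) A"
      then have "y \<in> Val Q A" using component_in[OF Hom_SP_D[OF \<alpha>] A] by blast
      then obtain D e g where De: "(D, e) \<in> G" and g: "g \<in> Hom C A D" and y_eq: "y = Act Q g e"
        using G(3)[OF A] by blast
      have "g \<in> \<phi> \<alpha> (D, e)" using De g y y_eq by (auto simp: \<phi>_def in_Hom_iff)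
      then have "g \<in> \<phi> \<beta> (D, e)" using eq by simp
      then show "y \<in> component \<beta> A ` Val (Dom SP \<beta>) A" using De g y_eq by (auto simp: \<phi>_def in_Hom_iff)
    qed
    have inj: "inj_on (component \<alpha> A) (Val (Dom SP \<alpha>) A)" if "\<alpha> \<in> ?X" "A \<in> Obj C" for \<alpha> A
      using PM_inj[OF _ PM_Hom, of \<alpha> A] that by simp
    obtain h where h: "h \<in> Hom SP (Dom SP \<mu>) (Dom SP \<nu>)" "Comp SP \<nu> h = \<mu>"
      by (rule factor_through_injective[OF \<mu>H \<nu>H inj[OF \<nu>] sub[OF \<mu>H eq]])
    obtain k where k: "k \<in> Hom SP (Dom SP \<nu>) (Dom SP \<mu>)" "Comp SP \<mu> k = \<nu>"
      by (rule factor_through_injective[OF \<nu>H \<mu>H inj[OF \<mu>] sub[OF \<nu>H eq[symmetric]]])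
    show "(\<mu>, \<nu>) \<in> iso_over SP PM Q"
      using SP.iso_over_antisym[OF monic_PM monic_PM _ _ _ _ h k] \<mu> \<nu> by blast
  qed
qed

end

theorem lemma40:
  fixes \<kappa> :: "'a rel" and C :: "('o, 'a) cat" and M :: "'a set"
  assumes "universe \<kappa>"
    and "locally_small_M_category \<kappa> C M"
  shows "locally_small_M_category \<kappa> (small_presheaves \<kappa> C) (presheaf_monics \<kappa> C M)"
proof -
  interpret category C
    using assms(2) by (simp add: locally_small_M_category_def M_category_def)
  interpret locally_small_M C \<kappa> M
    using assms
    by unfold_locales (auto simp: locally_small_M_category_def M_category_def locally_small_category_def)
  show ?thesis
    using category_SP stable_system_PM locally_small_category_SP well_powered_PM
    by (simp add: locally_small_M_category_def M_category_def)
qed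

end
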